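(* Let $f\in L^1(Q)$, $Q=(-\pi,\pi)$, be a complex-valued function with Fourier coefficients $a_k=\frac1{2\pi}\int_{-\pi}^{\pi}f(x)e^{-ikx}\,dx$, $k\in\mathbb{Z}$, and let $\alpha\ge 1$ be a fixed integer. For $n\ge1$ let $T_{n,\alpha}=\left[a_{r-\alpha c}\right]_{r,c=0}^{n-1}$ be the $\alpha$-Toeplitz matrix of size $n$ generated by $f$. Then $$\{T_{n,\alpha}\}_n\sim_\sigma(\theta,\,Q\times[0,1]),$$ where $$\theta(x,t)=\begin{cases}\sqrt{\widehat{|f|^{(2)}}(x)} & \text{for } t\in\left[0,\frac1\alpha\right],\\[2pt] 0 & \text{for } t\in\left(\frac1\alpha,1\right],\end{cases}\qquad \widehat{|f|^{(2)}}(x)=\frac1\alpha\sum_{j=0}^{\alpha-1}|f|^2\!\left(\frac{x+2\pi j}{\alpha}\right),$$ and the arguments of $|f|^2$ are taken modulo $2\pi$ (i.e. $f$ is extended $2\pi$-periodically).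
   Context: Let $\mathcal{C}_0(\mathbb{R}^+_0)$ be the set of continuous functions with bounded support on $[0,\infty)$. For an $n\times n$ matrix $A$ with singular values $\sigma_1(A),\dots,\sigma_n(A)$ and a function $F$ on $[0,\infty)$ put $\Sigma_\sigma(F,A)=\frac1n\sum_{j=1}^nF(\sigma_j(A))$. Let $\theta$ be a complex-valued measurable function on a set $G\subset\mathbb{R}^d$ of finite positive Lebesgue measure $\mu(G)$. A matrix sequence $\{A_n\}$, with $A_n$ of size $n\times n$, is said to be distributed in the sense of the singular values as $(\theta,G)$, written $\{A_n\}\sim_\sigma(\theta,G)$, if for every $F\in\mathcal{C}_0(\mathbb{R}^+_0)$ $$\lim_{n\to\infty}\Sigma_\sigma(F,A_n)=\frac1{\mu(G)}\int_GF(|\theta(t)|)\,dt.$$ *)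

theory Defs
  imports
    "HOL-Analysis.Analysis"
    "HOL-Library.Real_Mod"
    "Jordan_Normal_Form.Schur_Decomposition"
    "HOL-Computational_Algebra.Fundamental_Theorem_Algebra"
begin

(* Several constants are written qualified because HOL-Analysis and Jordan_Normal_Form both
   define a constant called mat. *)

(* The singular values of A, with multiplicity: the nonnegative square roots of the eigenvalues
   of A^* A, which are real and nonnegative, so that Re loses nothing. *)
definition singular_values :: "complex Matrix.mat \<Rightarrow> real multiset" where
  "singular_values A =
     image_mset (\<lambda>z. sqrt (Re z)) (proots (char_poly (mat_adjoint A * A)))"

lemma size_singular_values:
  assumes "A \<in> carrier_mat n n"
  shows "size (singular_values A) = n"
proof -
  have "mat_adjoint A * A \<in> carrier_mat n n"
    using assms by (auto simp: mat_adjoint_def)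
  from degree_monic_char_poly[OF this] show ?thesis
    by (simp add: singular_values_def size_proots_complex)
qed

definition C0_nonneg :: "(real \<Rightarrow> complex) set" where
  "C0_nonneg = {F. continuous_on {0..} F \<and> bounded {x \<in> {0..}. F x \<noteq> 0}}"

(* Sigma_sigma(F, A) for A of size n x n *)
definition sv_mean :: "(real \<Rightarrow> complex) \<Rightarrow> complex Matrix.mat \<Rightarrow> complex" where
  "sv_mean F A = (\<Sum>s\<in>#singular_values A. F s) / of_nat (dim_row A)"

definition sv_distributed ::
  "(nat \<Rightarrow> complex Matrix.mat) \<Rightarrow> ('a::euclidean_space \<Rightarrow> complex) \<Rightarrow> 'a set \<Rightarrow> bool" where
  "sv_distributed A \<theta> G \<longleftrightarrow>
     (\<forall>n. A n \<in> carrier_mat n n) \<and>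
     G \<in> lmeasurable \<and> measure lebesgue G > 0 \<and>
     \<theta> \<in> borel_measurable (lebesgue_on G) \<and>
     (\<forall>F\<in>C0_nonneg.
        (\<lambda>n. sv_mean F (A n)) \<longlonglongrightarrow>
          (LINT t:G|lebesgue. F (cmod (\<theta> t))) / of_real (measure lebesgue G))"

definition fourier_coeff :: "(real \<Rightarrow> complex) \<Rightarrow> int \<Rightarrow> complex" where
  "fourier_coeff f k =
     1 / (2 * of_real pi) *
     (LINT x:{-pi<..<pi}|lebesgue. f x * exp (- \<i> * of_int k * of_real x))"

definition alpha_toeplitz :: "(real \<Rightarrow> complex) \<Rightarrow> nat \<Rightarrow> nat \<Rightarrow> complex Matrix.mat" where
  "alpha_toeplitz f \<alpha> n =
     Matrix.mat n n (\<lambda>(r, c). fourier_coeff f (int r - int \<alpha> * int c))"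

(* The 2 pi-periodic extension of f restricted to [-pi, pi). *)
definition periodic_ext :: "(real \<Rightarrow> complex) \<Rightarrow> real \<Rightarrow> complex" where
  "periodic_ext f x = f ((x + pi) rmod (2 * pi) - pi)"

definition hat_abs_sq :: "(real \<Rightarrow> complex) \<Rightarrow> nat \<Rightarrow> real \<Rightarrow> real" where
  "hat_abs_sq f \<alpha> x =
     1 / real \<alpha> * (\<Sum>j<\<alpha>. (cmod (periodic_ext f ((x + 2 * pi * real j) / real \<alpha>)))\<^sup>2)"

definition theta_symbol :: "(real \<Rightarrow> complex) \<Rightarrow> nat \<Rightarrow> real \<times> real \<Rightarrow> complex" where
  "theta_symbol f \<alpha> = (\<lambda>(x, t).
     if t \<in> {0..1 / real \<alpha>} then of_real (sqrt (hat_abs_sq f \<alpha> x)) else 0)"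

end

(* The functions F_t(s) = 1 / (s^2 + t) with t > 0 generate all test functions under linear
   combinations and uniform limits, and n * sv_mean F_t A is the trace of the resolvent
   R = (A^* A + t)^(-1). So only normalised traces of resolvents have to be controlled.

   Since T_n(f) is an integral of rank-one matrices with unimodular vectors, its trace norm is at
   most n |f|_1 / (2 pi), and the resolvent identity gives |tr R_f - tr R_g| <= C_t n |f - g|_1.
   Hence f may be replaced by a trigonometric polynomial p.

   For such p put h = hat |p|^2 and m = n div alpha.  Away from O(1) rows, A^* A is the Toeplitz
   matrix of h on the first m indices and 0 on the others, so the block diagonal matrix
   diag(T_m(1 / (h + t)), 1 / t) inverts A^* A + t up to O(1) rows of bounded entries. This changes
   the trace by O(sqrt n) only, and the trace of the block matrix is explicit. *)

theory Submission
  imports Defs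
begin

section \<open>Traces of resolvents and singular values\<close>

text \<open>For \<open>f\<close> in L^1 the function |f|^2 may fail to be integrable, so
  \<open>A^* A\<close> has no symbol to compute with, and its powers are not controlled by the L^1
  norm of \<open>f\<close>. The resolvents R of A and S of B avoid this: R - S = R ((B - A)^* B +
  A^* (B - A)) S. The factors without a bound of their own occur only as B S and R A^*, of norm at
  most 1 / sqrt t, and B - A is linear in the symbol. Hence the reduction to polynomials has to
  precede any computation of \<open>A^* A\<close>.

  The fibre average comes from the columns: columns c and k of A multiply coefficients with indices
  r - \<alpha> c and r - \<alpha> k, which differ by a multiple of \<alpha>, and averaging over the
  \<alpha> preimages of x keeps exactly these frequencies of |p|^2. Columns beyond n / \<alpha> +
  O(1) leave the band of p and vanish; this is the zero part of the symbol. The error sqrt n comes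
  from pairing a column of the resolvent, of norm at most 1 / t, with a row of n bounded
  entries.\<close>

definition mtrace :: "complex Matrix.mat \<Rightarrow> complex" where
  "mtrace A = (\<Sum>i<dim_row A. A $$ (i, i))"

text \<open>Vectors are total functions on the naturals, of which only the entries below the
  dimension count. This avoids carrier conditions on vectors and lets conjugates and characters be
  written as lambda terms; equalities of images then carry an index bound.\<close>

definition mapp :: "complex Matrix.mat \<Rightarrow> (nat \<Rightarrow> complex) \<Rightarrow> nat \<Rightarrow> complex" where
  "mapp A v i = (\<Sum>j<dim_col A. A $$ (i, j) * v j)"

definition l2norm :: "nat \<Rightarrow> (nat \<Rightarrow> complex) \<Rightarrow> real" where
  "l2norm n v = L2_set (\<lambda>i. cmod (v i)) {..<n}"

section \<open>Traces, matrix-vector products and Euclidean norms\<close>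

lemma index_mult_mat_sum:
  assumes "A \<in> carrier_mat n m" "B \<in> carrier_mat m k" "i < n" "j < k"
  shows "(A * B) $$ (i, j) = (\<Sum>l<m. A $$ (i, l) * B $$ (l, j))"
  using assms by (auto simp: scalar_prod_def lessThan_atLeast0 intro!: sum.cong)

lemma dim_mat_adjoint [simp]:
  "dim_row (mat_adjoint A) = dim_col A" "dim_col (mat_adjoint A) = dim_row A"
  by (auto simp: mat_adjoint_def)

lemma mat_adjoint_carrier [simp]:
  "A \<in> carrier_mat n m \<Longrightarrow> mat_adjoint A \<in> carrier_mat m n"
  by (auto intro: carrier_matI)

lemma gram_carrier [simp]:
  "A \<in> carrier_mat n n \<Longrightarrow> mat_adjoint A * A \<in> carrier_mat n n"
  by (rule mult_carrier_mat[OF mat_adjoint_carrier])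

lemma index_mat_adjoint:
  "i < dim_col A \<Longrightarrow> j < dim_row A \<Longrightarrow>
    mat_adjoint A $$ (i, j) = cnj ((A :: complex Matrix.mat) $$ (j, i))"
  by (auto simp: mat_adjoint_def mat_of_rows_def)

lemma mtrace_mult:
  assumes "A \<in> carrier_mat n m" "B \<in> carrier_mat m n"
  shows "mtrace (A * B) = (\<Sum>i<n. \<Sum>j<m. A $$ (i, j) * B $$ (j, i))"
  using assms by (simp add: mtrace_def index_mult_mat_sum[OF assms] del: index_mult_mat(1))

lemma mtrace_mult_comm:
  assumes "A \<in> carrier_mat n m" "B \<in> carrier_mat m n"
  shows "mtrace (A * B) = mtrace (B * A)"
  unfolding mtrace_mult[OF assms] mtrace_mult[OF assms(2,1)]
  by (subst sum.swap) (simp add: mult.commute)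

lemma mtrace_add:
  assumes "A \<in> carrier_mat n n" "B \<in> carrier_mat n n"
  shows "mtrace (A + B) = mtrace A + mtrace B"
  using assms by (simp add: mtrace_def sum.distrib)

lemma mtrace_diff:
  assumes "A \<in> carrier_mat n n" "B \<in> carrier_mat n n"
  shows "mtrace (A - B) = mtrace A - mtrace B"
  using assms by (simp add: mtrace_def sum_subtractf)

lemma mapp_mult:
  assumes "A \<in> carrier_mat n m" "B \<in> carrier_mat m k" "i < n"
  shows "mapp (A * B) v i = mapp A (mapp B v) i"
proof -
  have "mapp (A * B) v i = (\<Sum>j<k. (\<Sum>l<m. A $$ (i, l) * B $$ (l, j)) * v j)"
    unfolding mapp_def using assms(1,2)
    by (auto intro!: sum.cong simp: index_mult_mat_sum[OF assms(1,2,3)] simp del: index_mult_mat(1))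
  also have "\<dots> = (\<Sum>l<m. \<Sum>j<k. A $$ (i, l) * B $$ (l, j) * v j)"
    by (subst sum.swap) (simp add: sum_distrib_right)
  also have "\<dots> = mapp A (mapp B v) i"
    unfolding mapp_def using assms(1,2) by (auto simp: sum_distrib_left mult.assoc)
  finally show ?thesis .
qed

lemma mapp_add:
  assumes "A \<in> carrier_mat n m" "B \<in> carrier_mat n m" "i < n"
  shows "mapp (A + B) v i = mapp A v i + mapp B v i"
  using assms by (auto simp: mapp_def sum.distrib ring_distribs)

lemma mapp_one: "i < n \<Longrightarrow> mapp (1\<^sub>m n) v i = v i"
proof -
  assume i: "i < n"
  have "mapp (1\<^sub>m n) v i = (\<Sum>j<n. if j = i then v j else 0)"
    unfolding mapp_def index_one_mat using i by (intro sum.cong) auto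
  also have "\<dots> = v i" using i by simp
  finally show ?thesis .
qed

lemma mapp_smult: 
  assumes "A \<in> carrier_mat n m" "i < n"
  shows "mapp (c \<cdot>\<^sub>m A) v i = c * mapp A v i"
  using assms by (auto simp: mapp_def sum_distrib_left intro!: sum.cong)

lemma mapp_cong:
  assumes "\<And>j. j < dim_col A \<Longrightarrow> v j = w j"
  shows "mapp A v i = mapp A w i"
  using assms by (simp add: mapp_def)

lemma mapp_adjoint:
  assumes "A \<in> carrier_mat n m"
  shows "(\<Sum>i<m. cnj (y i) * mapp (mat_adjoint A) x i) = (\<Sum>r<n. cnj (mapp A y r) * x r)"
proof -
  have "(\<Sum>i<m. cnj (y i) * mapp (mat_adjoint A) x i) = (\<Sum>i<m. \<Sum>r<n. cnj (y i) * (cnj (A $$ (r, i)) * x r))"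
    using assms by (auto simp: mapp_def sum_distrib_left index_mat_adjoint intro!: sum.cong)
  also have "\<dots> = (\<Sum>r<n. \<Sum>i<m. cnj (y i) * (cnj (A $$ (r, i)) * x r))"
    by (rule sum.swap)
  also have "\<dots> = (\<Sum>r<n. cnj (mapp A y r) * x r)"
    using assms by (auto simp: mapp_def sum_distrib_right intro!: sum.cong)
  finally show ?thesis .
qed

lemma l2norm_nonneg [simp]: "0 \<le> l2norm n v"
  by (simp add: l2norm_def L2_set_nonneg)

lemma l2norm_cong: "(\<And>i. i < n \<Longrightarrow> v i = w i) \<Longrightarrow> l2norm n v = l2norm n w"
  unfolding l2norm_def by (rule L2_set_cong) auto

lemma l2norm_sq: "complex_of_real ((l2norm n v)\<^sup>2) = (\<Sum>i<n. cnj (v i) * v i)"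
  by (simp add: l2norm_def L2_set_def sum_nonneg mult.commute flip: complex_norm_square)

lemma l2norm_Cauchy: "cmod (\<Sum>i<n. u i * v i) \<le> l2norm n u * l2norm n v"
proof -
  have "cmod (\<Sum>i<n. u i * v i) \<le> (\<Sum>i<n. \<bar>cmod (u i)\<bar> * \<bar>cmod (v i)\<bar>)"
    by (rule order_trans[OF norm_sum]) (simp add: norm_mult)
  also have "\<dots> \<le> l2norm n u * l2norm n v"
    unfolding l2norm_def by (rule L2_set_mult_ineq)
  finally show ?thesis .
qed

lemma l2norm_cnj [simp]: "l2norm n (\<lambda>i. cnj (v i)) = l2norm n v"
  by (simp add: l2norm_def)

lemma l2norm_unimodular: "(\<And>i. cmod (u i) = 1) \<Longrightarrow> l2norm n u = sqrt (real n)"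
  by (simp add: l2norm_def L2_set_def)

section \<open>Norm bounds for resolvents\<close>

definition resolvent_mat :: "nat \<Rightarrow> real \<Rightarrow> complex Matrix.mat \<Rightarrow> complex Matrix.mat \<Rightarrow> bool" where
  "resolvent_mat n t A R \<longleftrightarrow> A \<in> carrier_mat n n \<and> R \<in> carrier_mat n n \<and>
     (mat_adjoint A * A + of_real t \<cdot>\<^sub>m 1\<^sub>m n) * R = 1\<^sub>m n \<and>
     R * (mat_adjoint A * A + of_real t \<cdot>\<^sub>m 1\<^sub>m n) = 1\<^sub>m n"

lemma mapp_shifted_gram:
  assumes "A \<in> carrier_mat n n" "i < n"
  shows "mapp (mat_adjoint A * A + c \<cdot>\<^sub>m 1\<^sub>m n) y i = mapp (mat_adjoint A) (mapp A y) i + c * y i"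
  using assms by (subst mapp_add[of _ n n])
    (auto simp: mapp_mult[of _ n n _ n] mapp_smult[of _ n n] mapp_one)

text \<open>The energy identity: the equation \<open>(A^* A + t) y = z\<close> is tested against
  \<open>y\<close>, and \<open>A^*\<close> is moved to the other side. It is the common source of
  the resolvent bounds, of invertibility, and, with t = 0, of the reality of the
  eigenvalues.\<close>

lemma gram_form:
  assumes A: "A \<in> carrier_mat n n"
  assumes eq: "\<And>i. i < n \<Longrightarrow> mapp (mat_adjoint A * A + of_real t \<cdot>\<^sub>m 1\<^sub>m n) y i = z i"
  shows "complex_of_real ((l2norm n (mapp A y))\<^sup>2 + t * (l2norm n y)\<^sup>2) = (\<Sum>i<n. cnj (y i) * z i)"
proof -
  have "(\<Sum>i<n. cnj (y i) * z i) =
      (\<Sum>i<n. cnj (y i) * mapp (mat_adjoint A) (mapp A y) i) + (\<Sum>i<n. cnj (y i) * (of_real t * y i))"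
    using eq by (simp add: mapp_shifted_gram[OF A] flip: sum.distrib ring_distribs)
  also have "(\<Sum>i<n. cnj (y i) * mapp (mat_adjoint A) (mapp A y) i) = complex_of_real ((l2norm n (mapp A y))\<^sup>2)"
    by (simp only: mapp_adjoint[OF A] l2norm_sq)
  also have "(\<Sum>i<n. cnj (y i) * (of_real t * y i)) = of_real t * complex_of_real ((l2norm n y)\<^sup>2)"
    by (simp only: l2norm_sq sum_distrib_left) (simp add: mult_ac)
  finally show ?thesis by simp
qed

lemma resolvent_mapp:
  assumes "resolvent_mat n t A R" "i < n"
  shows "mapp (mat_adjoint A * A + of_real t \<cdot>\<^sub>m 1\<^sub>m n) (mapp R z) i = z i"
proof -
  have "mapp ((mat_adjoint A * A + of_real t \<cdot>\<^sub>m 1\<^sub>m n) * R) z i = z i"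
    using assms by (simp add: resolvent_mat_def mapp_one)
  moreover have "mapp ((mat_adjoint A * A + of_real t \<cdot>\<^sub>m 1\<^sub>m n) * R) z i =
      mapp (mat_adjoint A * A + of_real t \<cdot>\<^sub>m 1\<^sub>m n) (mapp R z) i"
    using assms by (intro mapp_mult[of _ n n _ n]) (auto simp: resolvent_mat_def)
  ultimately show ?thesis by simp
qed

lemma resolvent_energy:
  assumes "resolvent_mat n t A R"
  shows "(l2norm n (mapp A (mapp R z)))\<^sup>2 + t * (l2norm n (mapp R z))\<^sup>2
    \<le> l2norm n (mapp R z) * l2norm n z"
proof -
  have A: "A \<in> carrier_mat n n" using assms by (simp add: resolvent_mat_def)
  let ?e = "(l2norm n (mapp A (mapp R z)))\<^sup>2 + t * (l2norm n (mapp R z))\<^sup>2"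
  have "complex_of_real ?e = (\<Sum>i<n. cnj (mapp R z i) * z i)"
    by (rule gram_form[OF A]) (rule resolvent_mapp[OF assms])
  then have "\<bar>?e\<bar> = cmod (\<Sum>i<n. cnj (mapp R z i) * z i)"
    by (metis norm_of_real)
  also have "\<dots> \<le> l2norm n (mapp R z) * l2norm n z"
    using l2norm_Cauchy[of "\<lambda>i. cnj (mapp R z i)" z n] by simp
  finally show ?thesis by simp
qed

lemma resolvent_bound:
  assumes "resolvent_mat n t A R" "t > 0"
  shows "l2norm n (mapp R z) \<le> l2norm n z / t"
proof -
  let ?y = "l2norm n (mapp R z)"
  have "t * ?y\<^sup>2 \<le> ?y * l2norm n z"
    using resolvent_energy[OF assms(1), of z] zero_le_power2[of "l2norm n (mapp A (mapp R z))"] by linarith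
  then have "?y * (t * ?y) \<le> ?y * l2norm n z" by (simp add: power2_eq_square mult_ac)
  then have "t * ?y \<le> l2norm n z"
    using l2norm_nonneg[of n "mapp R z"] l2norm_nonneg[of n z]
    by (cases "?y = 0") (auto simp del: l2norm_nonneg)
  then show ?thesis using assms(2) by (simp add: field_simps)
qed

text \<open>The term |A R z|^2 of the energy is itself at most |R z| |z|. No bound on A enters, so
  the estimate is uniform in n and in the symbol.\<close>

lemma mult_resolvent_bound:
  assumes "resolvent_mat n t A R" "t > 0"
  shows "l2norm n (mapp A (mapp R z)) \<le> l2norm n z / sqrt t"
proof (rule power2_le_imp_le)
  have "(l2norm n (mapp A (mapp R z)))\<^sup>2 \<le> l2norm n (mapp R z) * l2norm n z"
    using resolvent_energy[OF assms(1), of z] assms(2)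
      zero_le_power2[of "l2norm n (mapp R z)"] mult_nonneg_nonneg[of t "(l2norm n (mapp R z))\<^sup>2"] by linarith
  also have "\<dots> \<le> l2norm n z / t * l2norm n z"
    by (intro mult_right_mono resolvent_bound[OF assms]) auto
  finally show "(l2norm n (mapp A (mapp R z)))\<^sup>2 \<le> (l2norm n z / sqrt t)\<^sup>2"
    using assms(2) by (simp add: power2_eq_square)
qed (use assms(2) in auto)

text \<open>The energy identity is applied directly with right side \<open>A^* x\<close>, and
  \<open>A^*\<close> is moved onto \<open>y\<close>; in this way no symmetry of R has to be
  established.\<close>

lemma resolvent_adjoint_bound:
  assumes "resolvent_mat n t A R" "t > 0"
  shows "l2norm n (mapp R (mapp (mat_adjoint A) x)) \<le> l2norm n x / sqrt t"
proof -
  have A: "A \<in> carrier_mat n n" using assms by (simp add: resolvent_mat_def)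
  define y where "y = mapp R (mapp (mat_adjoint A) x)"
  let ?e = "(l2norm n (mapp A y))\<^sup>2 + t * (l2norm n y)\<^sup>2"
  have "complex_of_real ?e = (\<Sum>i<n. cnj (y i) * mapp (mat_adjoint A) x i)"
    unfolding y_def by (rule gram_form[OF A]) (rule resolvent_mapp[OF assms(1)])
  also have "\<dots> = (\<Sum>i<n. cnj (mapp A y i) * x i)"
    by (rule mapp_adjoint[OF A])
  finally have "\<bar>?e\<bar> = cmod (\<Sum>i<n. cnj (mapp A y i) * x i)"
    by (metis norm_of_real)
  also have "\<dots> \<le> l2norm n (mapp A y) * l2norm n x"
    using l2norm_Cauchy[of "\<lambda>i. cnj (mapp A y i)" x n] by simp
  finally have e: "?e \<le> l2norm n (mapp A y) * l2norm n x" by simp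
  \<comment> \<open>A lossy form of the inequality between the means: with a = |A y| and b = |x| it
    gives a b \<le> a^2 + b^2, and a^2 then cancels against the first term of the energy.\<close>
  have "0 \<le> (l2norm n (mapp A y) - l2norm n x)\<^sup>2 + (l2norm n (mapp A y))\<^sup>2 + (l2norm n x)\<^sup>2" by simp
  then have "l2norm n (mapp A y) * l2norm n x \<le> (l2norm n (mapp A y))\<^sup>2 + (l2norm n x)\<^sup>2"
    by (simp add: power2_diff)
  with e have "t * (l2norm n y)\<^sup>2 \<le> (l2norm n x)\<^sup>2" by linarith
  then have "(l2norm n y)\<^sup>2 \<le> (l2norm n x / sqrt t)\<^sup>2"
    using assms(2) by (simp add: power_divide field_simps)
  then show ?thesis unfolding y_def[symmetric]
    by (rule power2_le_imp_le) (use assms(2) in auto)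
qed

text \<open>A kernel vector of \<open>A^* A + t\<close> has zero energy, hence norm zero because t >
  0; so the determinant cannot vanish.\<close>

lemma resolvent_exists:
  assumes A: "A \<in> carrier_mat n n" and t: "t > 0"
  shows "\<exists>R. resolvent_mat n t A R"
proof -
  define G where "G = mat_adjoint A * A + of_real t \<cdot>\<^sub>m 1\<^sub>m n"
  have G: "G \<in> carrier_mat n n" using A by (auto simp: G_def)
  have "Determinant.det G \<noteq> 0"
  proof
    assume "Determinant.det G = 0"
    then obtain v where v: "v \<in> carrier_vec n" "v \<noteq> 0\<^sub>v n" "G *\<^sub>v v = 0\<^sub>v n"
      using det_0_iff_vec_prod_zero[OF G] by auto
    define y where "y = vec_index v"
    have Gy: "mapp G y i = 0" if "i < n" for i
    proof -
      have "mapp G y i = vec_index (G *\<^sub>v v) i"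
        using G v(1) that
        by (auto simp: mapp_def y_def scalar_prod_def lessThan_atLeast0 intro!: sum.cong)
      then show ?thesis using v(3) that by simp
    qed
    have "complex_of_real ((l2norm n (mapp A y))\<^sup>2 + t * (l2norm n y)\<^sup>2) = (\<Sum>i<n. cnj (y i) * 0)"
      by (rule gram_form[OF A]) (use Gy in \<open>simp add: G_def\<close>)
    then have "(l2norm n (mapp A y))\<^sup>2 + t * (l2norm n y)\<^sup>2 = 0" by (simp only: mult_zero_right sum.neutral_const of_real_eq_0_iff)
    then have "t * (l2norm n y)\<^sup>2 \<le> 0" using zero_le_power2[of "l2norm n (mapp A y)"] by linarith
    then have "l2norm n y = 0" using t by (simp add: mult_le_0_iff)
    then have "\<forall>i<n. y i = 0" by (simp add: l2norm_def L2_set_eq_0_iff)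
    then have "v = 0\<^sub>v n" using v(1) by (intro eq_vecI) (auto simp: y_def)
    with v(2) show False by simp
  qed
  from det_non_zero_imp_unit[OF G this, of "()"]
  obtain R where "R \<in> carrier_mat n n" "R * G = 1\<^sub>m n" "G * R = 1\<^sub>m n"
    unfolding Units_def ring_mat_def by auto
  then show ?thesis using A unfolding resolvent_mat_def G_def by blast
qed

section \<open>Eigenvalues of the Gram matrix and the trace of the resolvent\<close>

lemma gram_eigenvalue:
  assumes A: "A \<in> carrier_mat n n" and z: "poly (char_poly (mat_adjoint A * A)) z = 0"
  shows "z = of_real (Re z)" "Re z \<ge> 0"
proof -
  have M: "mat_adjoint A * A \<in> carrier_mat n n" using A by simp
  have "eigenvalue (mat_adjoint A * A) z" using eigenvalue_root_char_poly[OF M] z by simp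
  then obtain v where v: "v \<in> carrier_vec n" "v \<noteq> 0\<^sub>v n" "(mat_adjoint A * A) *\<^sub>v v = z \<cdot>\<^sub>v v"
    unfolding eigenvalue_def eigenvector_def using M by auto
  define y where "y = vec_index v"
  \<comment> \<open>The shift by 0 brings the eigenvector equation into the form of
    \<open>gram_form\<close>; the eigenvalue then is the Rayleigh quotient |A y|^2 / |y|^2.\<close>
  have My: "mapp (mat_adjoint A * A + of_real 0 \<cdot>\<^sub>m 1\<^sub>m n) y i = z * y i" if "i < n" for i
  proof -
    have "mapp (mat_adjoint A * A) y i = vec_index ((mat_adjoint A * A) *\<^sub>v v) i"
      using A v(1) that
      by (auto simp: mapp_def y_def scalar_prod_def lessThan_atLeast0 intro!: sum.cong)
    then have "mapp (mat_adjoint A * A) y i = z * y i" using v that by (simp add: y_def)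
    then show ?thesis using mapp_shifted_gram[OF A that, of 0 y] mapp_mult[OF _ A that, of "mat_adjoint A" y] A by simp
  qed
  have "complex_of_real ((l2norm n (mapp A y))\<^sup>2 + 0 * (l2norm n y)\<^sup>2) = (\<Sum>i<n. cnj (y i) * (z * y i))"
    by (rule gram_form[OF A]) (use My in simp)
  also have "\<dots> = z * complex_of_real ((l2norm n y)\<^sup>2)"
    by (simp only: l2norm_sq sum_distrib_left) (simp add: mult_ac)
  finally have eq: "z * complex_of_real ((l2norm n y)\<^sup>2) = complex_of_real ((l2norm n (mapp A y))\<^sup>2)" by simp
  have "l2norm n y \<noteq> 0"
  proof
    assume "l2norm n y = 0"
    then have "\<forall>i<n. y i = 0" by (simp add: l2norm_def L2_set_eq_0_iff)
    then have "v = 0\<^sub>v n" using v(1) by (intro eq_vecI) (auto simp: y_def)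
    with v(2) show False by simp
  qed
  with eq have "z = complex_of_real ((l2norm n (mapp A y))\<^sup>2 / (l2norm n y)\<^sup>2)"
    by (simp add: field_simps)
  then show "z = of_real (Re z)" "Re z \<ge> 0" by (metis Re_complex_of_real, metis Re_complex_of_real divide_nonneg_nonneg zero_le_power2)
qed

text \<open>Induction over the columns of \<open>V * U = 1\<close>. In an entry (i, j) with j \<le>
  i, the terms k < j vanish by the induction hypothesis for V and the terms k > j by triangularity
  of U, so only k = j survives.\<close>

lemma inverse_upper_triangular_diag:
  fixes U :: "complex Matrix.mat"
  assumes U: "U \<in> carrier_mat n n" "upper_triangular U" and V: "V \<in> carrier_mat n n"
    and inv: "V * U = 1\<^sub>m n" and nz: "\<And>i. i < n \<Longrightarrow> U $$ (i, i) \<noteq> 0"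
  shows "j < n \<Longrightarrow> (\<forall>i. j < i \<and> i < n \<longrightarrow> V $$ (i, j) = 0) \<and> V $$ (j, j) = 1 / U $$ (j, j)"
proof (induction j rule: less_induct)
  case (less j)
  have eq: "V $$ (i, j) * U $$ (j, j) = (if i = j then 1 else 0)" if "j \<le> i" "i < n" for i
  proof -
    have "(\<Sum>k<n. V $$ (i, k) * U $$ (k, j)) = (if i = j then 1 else 0)"
      using index_mult_mat_sum[OF V U(1) that(2) less.prems] inv that less.prems by simp
    moreover have "(\<Sum>k<n. V $$ (i, k) * U $$ (k, j)) = (\<Sum>k\<in>{j}. V $$ (i, k) * U $$ (k, j))"
    proof (intro sum.mono_neutral_right ballI)
      fix k assume k: "k \<in> {..<n} - {j}"
      show "V $$ (i, k) * U $$ (k, j) = 0"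
      proof (cases "k < j")
        case True
        then show ?thesis using less.IH[of k] that k by auto
      next
        case False
        then have "j < k" using k by auto
        then show ?thesis using U k by (auto simp: upper_triangular_def)
      qed
    qed (use less.prems in auto)
    ultimately show ?thesis by simp
  qed
  have "V $$ (i, j) = 0" if "j < i" "i < n" for i
    using eq[of i] nz[OF less.prems] that by simp
  then show ?case using eq[of j] nz[OF less.prems] less.prems by (simp add: field_simps)
qed

text \<open>A Schur form turns R into the inverse of an upper triangular matrix whose diagonal
  consists of the shifted eigenvalues. The trace is invariant under similarity and needs only the
  diagonal of that inverse, so triangularity can replace diagonalisation.\<close>

lemma sum_singular_values_resolvent:
  assumes R: "resolvent_mat n t A R" and t: "t > 0"
  shows "(\<Sum>s\<in>#singular_values A. complex_of_real (1 / (s\<^sup>2 + t))) = mtrace R"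
proof -
  have A: "A \<in> carrier_mat n n" and Rc: "R \<in> carrier_mat n n"
    using R by (auto simp: resolvent_mat_def)
  define M where "M = mat_adjoint A * A"
  have M: "M \<in> carrier_mat n n" using A by (simp add: M_def)
  \<comment> \<open>The Schur decomposition takes the eigenvalues as a list; any enumeration of the
    multiset of roots serves, since the final sum is symmetric.\<close>
  define es where "es = (SOME es. mset es = proots (char_poly M))"
  have es: "mset es = proots (char_poly M)"
    unfolding es_def by (rule someI_ex) (rule ex_mset)
  have cp: "char_poly M = (\<Prod>e\<leftarrow>es. [:- e, 1:])"
    using complex_poly_decompose_multiset[of "char_poly M"] degree_monic_char_poly[OF M]
    by (simp flip: es mset_map add: prod_mset_prod_list)
  obtain U P Q where UPQ: "schur_decomposition M es = (U, P, Q)" by (metis prod_cases3)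
  from schur_decomposition[OF M cp UPQ]
  have sim: "similar_mat_wit M U P Q" and ut: "upper_triangular U" and dg: "diag_mat U = es" by auto
  from similar_mat_witD2[OF M sim]
  have PQ: "P * Q = 1\<^sub>m n" "Q * P = 1\<^sub>m n" and MU: "M = P * U * Q"
    and U: "U \<in> carrier_mat n n" and P: "P \<in> carrier_mat n n" and Q: "Q \<in> carrier_mat n n" by auto
  have pos: "U $$ (i, i) = of_real (Re (U $$ (i, i)))" "Re (U $$ (i, i)) \<ge> 0" if "i < n" for i
  proof -
    have "U $$ (i, i) \<in> set es" unfolding dg[symmetric] diag_mat_def using U that by auto
    then have "U $$ (i, i) \<in># proots (char_poly M)" by (simp flip: es)
    then have "poly (char_poly M) (U $$ (i, i)) = 0"
      using degree_monic_char_poly[OF M] by (cases "char_poly M = 0") auto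
    from gram_eigenvalue[OF A this[unfolded M_def]]
    show "U $$ (i, i) = of_real (Re (U $$ (i, i)))" "Re (U $$ (i, i)) \<ge> 0" by auto
  qed
  define U' where "U' = U + of_real t \<cdot>\<^sub>m 1\<^sub>m n"
  have U': "U' \<in> carrier_mat n n" "upper_triangular U'"
    using U ut by (auto simp: U'_def upper_triangular_def)
  have U'd: "U' $$ (i, i) = of_real (Re (U $$ (i, i)) + t)" if "i < n" for i
    using U that pos(1)[OF that] by (simp add: U'_def) 
  have U'nz: "U' $$ (i, i) \<noteq> 0" if "i < n" for i
    unfolding U'd[OF that] of_real_eq_0_iff using pos(2)[OF that] t by linarith
  have "Q * (M + of_real t \<cdot>\<^sub>m 1\<^sub>m n) * P = U'"
  proof -
    have "Q * M * P = Q * (P * U * Q) * P" by (simp add: MU)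
    also have "\<dots> = (Q * P) * U * (Q * P)"
      using P Q U by (simp add: assoc_mult_mat[of _ n n _ n _ n])
    finally have "Q * M * P = U" using U PQ by simp
    moreover have "Q * (of_real t \<cdot>\<^sub>m 1\<^sub>m n) * P = of_real t \<cdot>\<^sub>m 1\<^sub>m n"
      using P Q PQ mult_smult_distrib[OF Q one_carrier_mat, of "complex_of_real t"]
        mult_smult_assoc_mat[OF Q P, of "complex_of_real t"] by simp
    ultimately show ?thesis
      using P Q M by (simp add: U'_def mult_add_distrib_mat[of _ n n _ n] add_mult_distrib_mat[of _ n n _ _ n])
  qed
  then have "(Q * R * P) * U' = Q * (R * (P * Q) * (M + of_real t \<cdot>\<^sub>m 1\<^sub>m n)) * P"
    using P Q M Rc by (auto simp: assoc_mult_mat[of _ n n _ n _ n] mult_carrier_mat[of _ n n _ n])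
  also have "\<dots> = 1\<^sub>m n"
    using R P Q Rc PQ by (simp add: resolvent_mat_def M_def)
  finally have inv: "(Q * R * P) * U' = 1\<^sub>m n" .
  have QRP: "Q * R * P \<in> carrier_mat n n" using P Q Rc by auto
  have "mtrace R = mtrace (Q * R * P)"
  proof -
    have "mtrace (Q * R * P) = mtrace (P * (Q * R))"
      by (rule mtrace_mult_comm[of _ n n]) (use P Q Rc in auto)
    also have "P * (Q * R) = P * Q * R" using P Q Rc by (simp add: assoc_mult_mat[of _ n n _ n _ n])
    finally show ?thesis using PQ Rc by simp
  qed
  also have "\<dots> = (\<Sum>i<n. 1 / U' $$ (i, i))"
    using inverse_upper_triangular_diag[OF U' QRP inv U'nz] QRP unfolding mtrace_def by auto
  also have "\<dots> = (\<Sum>i<n. complex_of_real (1 / ((sqrt (Re (U $$ (i, i))))\<^sup>2 + t)))"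
    using U'd pos by (intro sum.cong) auto
  also have "\<dots> = (\<Sum>e\<leftarrow>es. complex_of_real (1 / ((sqrt (Re e))\<^sup>2 + t)))"
    unfolding dg[symmetric] diag_mat_def using U
    by (simp add: sum_list_sum_nth lessThan_atLeast0)
  also have "\<dots> = (\<Sum>s\<in>#singular_values A. complex_of_real (1 / (s\<^sup>2 + t)))"
    unfolding singular_values_def M_def[symmetric] es[symmetric] 
    by (simp add: image_mset.compositionality o_def flip: sum_mset_sum_list)
  finally show ?thesis by simp
qed

text \<open>The assumption \<open>small\<close> states by duality that B - A has trace norm at most
  n \<epsilon>: Z ranges over matrices controlled as bilinear forms. Control on unimodular vectors
  is the form in which it can be verified for Toeplitz matrices. The two halves of the resolvent
  identity contribute 1 / (t sqrt t) each, one factor 1 / t from a bare resolvent and one factor 1 /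
  sqrt t from B S or R A^*.\<close>

lemma resolvent_trace_perturb:
  assumes RA: "resolvent_mat n t A R" and RB: "resolvent_mat n t B S" and t: "t > 0"
    and small: "\<And>Z K. K \<ge> 0 \<Longrightarrow>
      (\<And>u v :: nat \<Rightarrow> complex. (\<And>i. cmod (u i) = 1) \<Longrightarrow> (\<And>i. cmod (v i) = 1) \<Longrightarrow>
         cmod (\<Sum>r<n. \<Sum>c<n. u r * Z r c * v c) \<le> K * real n) \<Longrightarrow>
      cmod (\<Sum>r<n. \<Sum>c<n. (B $$ (r, c) - A $$ (r, c)) * Z r c) \<le> K * real n * \<epsilon>"
  shows "cmod (mtrace R - mtrace S) \<le> 2 / (t * sqrt t) * real n * \<epsilon>"
proof -
  have c: "A \<in> carrier_mat n n" "B \<in> carrier_mat n n" "R \<in> carrier_mat n n" "S \<in> carrier_mat n n"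
    using RA RB by (auto simp: resolvent_mat_def)
  let ?A' = "mat_adjoint A" and ?B' = "mat_adjoint B"
  let ?t = "complex_of_real t \<cdot>\<^sub>m 1\<^sub>m n"
  have c': "?A' \<in> carrier_mat n n" "?B' \<in> carrier_mat n n" "?t \<in> carrier_mat n n" using c by auto
  \<comment> \<open>\<open>X1\<close> and \<open>X2\<close> are the cofactors of
    \<open>(B - A)^*\<close> and of \<open>B - A\<close> after cyclic permutation under the
    trace.\<close>
  define X1 where "X1 = B * S * R"
  define X2 where "X2 = S * R * ?A'"
  have X: "X1 \<in> carrier_mat n n" "X2 \<in> carrier_mat n n" using c c' by (auto simp: X1_def X2_def)
  have "mtrace R = mtrace (R * (?B' * B + ?t) * S)"
    using RB c c' by (simp add: resolvent_mat_def assoc_mult_mat[of _ n n _ n _ n])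
  also have "R * (?B' * B + ?t) * S = R * ?B' * B * S + R * ?t * S"
    using c c' by (simp add: mult_add_distrib_mat[of _ n n _ n] add_mult_distrib_mat[of _ n n _ _ n] assoc_mult_mat[of _ n n _ n _ n] mult_carrier_mat[of _ n n _ n])
  also have "mtrace \<dots> = mtrace (R * ?B' * B * S) + mtrace (R * ?t * S)"
    using c c' by (intro mtrace_add) auto
  finally have 1: "mtrace R = mtrace (R * ?B' * B * S) + mtrace (R * ?t * S)" .
  have "mtrace S = mtrace (R * (?A' * A + ?t) * S)"
    using RA c c' by (simp add: resolvent_mat_def)
  also have "R * (?A' * A + ?t) * S = R * ?A' * A * S + R * ?t * S"
    using c c' by (simp add: mult_add_distrib_mat[of _ n n _ n] add_mult_distrib_mat[of _ n n _ _ n] assoc_mult_mat[of _ n n _ n _ n] mult_carrier_mat[of _ n n _ n])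
  also have "mtrace \<dots> = mtrace (R * ?A' * A * S) + mtrace (R * ?t * S)"
    using c c' by (intro mtrace_add) auto
  finally have 2: "mtrace S = mtrace (R * ?A' * A * S) + mtrace (R * ?t * S)" .
  have t1: "mtrace (R * ?B' * B * S) = mtrace (?B' * X1)"
  proof -
    have "R * ?B' * B * S = R * (?B' * B * S)" using c c' by (simp add: assoc_mult_mat[of _ n n _ n _ n])
    also have "mtrace \<dots> = mtrace ((?B' * B * S) * R)" using c c' by (intro mtrace_mult_comm) auto
    also have "(?B' * B * S) * R = ?B' * X1" using c c' by (simp add: X1_def assoc_mult_mat[of _ n n _ n _ n])
    finally show ?thesis .
  qed
  have t2: "mtrace (R * ?A' * B * S) = mtrace (?A' * X1)"
  proof -
    have "R * ?A' * B * S = R * (?A' * B * S)" using c c' by (simp add: assoc_mult_mat[of _ n n _ n _ n] mult_carrier_mat[of _ n n _ n])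
    also have "mtrace \<dots> = mtrace ((?A' * B * S) * R)" using c c' by (intro mtrace_mult_comm) auto
    also have "(?A' * B * S) * R = ?A' * X1" using c c' by (simp add: X1_def assoc_mult_mat[of _ n n _ n _ n])
    finally show ?thesis .
  qed
  have t3: "mtrace (R * ?A' * D * S) = mtrace (D * X2)" if "D \<in> carrier_mat n n" for D
  proof -
    have "R * ?A' * D * S = (R * ?A') * (D * S)" using c c' that by (simp add: assoc_mult_mat[of _ n n _ n _ n] mult_carrier_mat[of _ n n _ n])
    also have "mtrace \<dots> = mtrace ((D * S) * (R * ?A'))" using c c' that by (intro mtrace_mult_comm) auto
    also have "(D * S) * (R * ?A') = D * X2" using c c' that by (simp add: X2_def assoc_mult_mat[of _ n n _ n _ n])
    finally show ?thesis .
  qed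
  \<comment> \<open>The difference telescopes through the mixed trace of
    \<open>R A^* B S\<close>.\<close>
  have "mtrace R - mtrace S = (mtrace (?B' * X1) - mtrace (?A' * X1)) + (mtrace (B * X2) - mtrace (A * X2))"
    using 1 2 t1 t2 t3[OF c(1)] t3[OF c(2)] by simp
  also have "mtrace (?B' * X1) - mtrace (?A' * X1) = (\<Sum>i<n. \<Sum>j<n. cnj (B $$ (j, i) - A $$ (j, i)) * X1 $$ (j, i))"
    using c c' X by (simp add: mtrace_mult[of _ n n] index_mat_adjoint left_diff_distrib sum_subtractf)
  \<comment> \<open>This half contains the conjugated entries of B - A, so the whole sum is
    conjugated and \<open>small\<close> is later used with the conjugate of
    \<open>X1\<close>.\<close>
  also have "\<dots> = cnj (\<Sum>j<n. \<Sum>i<n. (B $$ (j, i) - A $$ (j, i)) * cnj (X1 $$ (j, i)))"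
    by (subst sum.swap) simp
  also have "mtrace (B * X2) - mtrace (A * X2) = (\<Sum>i<n. \<Sum>j<n. (B $$ (i, j) - A $$ (i, j)) * X2 $$ (j, i))"
    using c X by (simp add: mtrace_mult[of _ n n] left_diff_distrib sum_subtractf)
  finally have eq: "mtrace R - mtrace S = cnj (\<Sum>j<n. \<Sum>i<n. (B $$ (j, i) - A $$ (j, i)) * cnj (X1 $$ (j, i)))
      + (\<Sum>i<n. \<Sum>j<n. (B $$ (i, j) - A $$ (i, j)) * X2 $$ (j, i))" .
  let ?K = "1 / (t * sqrt t)"
  have K: "?K \<ge> 0" using t by simp
  have X1b: "l2norm n (mapp X1 w) \<le> ?K * l2norm n w" for w
  proof -
    have "l2norm n (mapp X1 w) = l2norm n (mapp B (mapp S (mapp R w)))"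
      unfolding X1_def using c
      by (intro l2norm_cong) (simp add: mapp_mult[of _ n n _ n] cong: mapp_cong)
    also have "\<dots> \<le> l2norm n (mapp R w) / sqrt t"
      by (rule mult_resolvent_bound[OF RB t])
    also have "\<dots> \<le> (l2norm n w / t) / sqrt t"
      using resolvent_bound[OF RA t] t by (intro divide_right_mono) auto
    finally show ?thesis by (simp add: field_simps)
  qed
  have X2b: "l2norm n (mapp X2 w) \<le> ?K * l2norm n w" for w
  proof -
    have "mapp X2 w i = mapp S (mapp R (mapp ?A' w)) i" if "i < n" for i
    proof -
      have "mapp X2 w i = mapp (S * R) (mapp ?A' w) i" 
        unfolding X2_def using c c' that by (intro mapp_mult[of _ n n _ n]) auto
      also have "\<dots> = mapp S (mapp R (mapp ?A' w)) i" using c that by (intro mapp_mult[of _ n n _ n]) auto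
      finally show ?thesis .
    qed
    then have "l2norm n (mapp X2 w) = l2norm n (mapp S (mapp R (mapp ?A' w)))"
      by (rule l2norm_cong)
    also have "\<dots> \<le> l2norm n (mapp R (mapp ?A' w)) / t"
      by (rule resolvent_bound[OF RB t])
    also have "\<dots> \<le> (l2norm n w / sqrt t) / t"
      using resolvent_adjoint_bound[OF RA t] t by (intro divide_right_mono) auto
    finally show ?thesis by (simp add: field_simps)
  qed
  \<comment> \<open>Two unimodular vectors have norm sqrt n each, so an operator bound K yields K n
    for the bilinear form.\<close>
  have form: "cmod (\<Sum>r<n. u r * mapp X v r) \<le> ?K * real n"
    if "\<And>w. l2norm n (mapp X w) \<le> ?K * l2norm n w"
      "\<And>i. cmod (u i) = 1" "\<And>i. cmod (v i) = 1" for X u v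
  proof -
    have "cmod (\<Sum>r<n. u r * mapp X v r) \<le> l2norm n u * l2norm n (mapp X v)"
      by (rule l2norm_Cauchy)
    also have "\<dots> \<le> l2norm n u * (?K * l2norm n v)" by (intro mult_left_mono that) auto
    also have "\<dots> = ?K * real n" using that by (simp add: l2norm_unimodular)
    finally show ?thesis .
  qed
  have b1: "cmod (\<Sum>j<n. \<Sum>i<n. (B $$ (j, i) - A $$ (j, i)) * cnj (X1 $$ (j, i))) \<le> ?K * real n * \<epsilon>"
  proof (rule small[OF K])
    fix u v :: "nat \<Rightarrow> complex" assume uv: "\<And>i. cmod (u i) = 1" "\<And>i. cmod (v i) = 1"
    have "(\<Sum>r<n. \<Sum>c<n. u r * cnj (X1 $$ (r, c)) * v c) = cnj (\<Sum>r<n. cnj (u r) * mapp X1 (\<lambda>c. cnj (v c)) r)"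
      using X by (simp add: mapp_def sum_distrib_left mult.assoc)
    then show "cmod (\<Sum>r<n. \<Sum>c<n. u r * cnj (X1 $$ (r, c)) * v c) \<le> ?K * real n"
      using form[OF X1b, of "\<lambda>r. cnj (u r)" "\<lambda>r. cnj (v r)"] uv
      by (simp only: complex_mod_cnj)
  qed
  \<comment> \<open>A trace pairs (i, j) with (j, i), so here Z is the transpose of
    \<open>X2\<close>, and u and v exchange their places.\<close>
  have b2: "cmod (\<Sum>i<n. \<Sum>j<n. (B $$ (i, j) - A $$ (i, j)) * X2 $$ (j, i)) \<le> ?K * real n * \<epsilon>"
  proof (rule small[OF K])
    fix u v :: "nat \<Rightarrow> complex" assume uv: "\<And>i. cmod (u i) = 1" "\<And>i. cmod (v i) = 1"
    have "(\<Sum>r<n. \<Sum>c<n. u r * X2 $$ (c, r) * v c) = (\<Sum>c<n. v c * mapp X2 u c)"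
      by (subst sum.swap) (use X in \<open>simp add: mapp_def sum_distrib_left mult_ac\<close>)
    then show "cmod (\<Sum>r<n. \<Sum>c<n. u r * X2 $$ (c, r) * v c) \<le> ?K * real n"
      using form[OF X2b, of v u] uv by simp
  qed
  have "cmod (mtrace R - mtrace S) \<le> ?K * real n * \<epsilon> + ?K * real n * \<epsilon>"
    unfolding eq by (rule order_trans[OF norm_triangle_ineq add_mono]) (use b1 b2 in \<open>simp_all only: complex_mod_cnj\<close>)
  then show ?thesis by (simp add: mult_ac)
qed

section \<open>Fourier coefficients and \<open>\<alpha>\<close>-Toeplitz matrices\<close>

abbreviation Qm :: "real measure" where
  "Qm \<equiv> lebesgue_on {-pi<..<pi}"

lemma measure_Qm: "measure Qm (space Qm) = 2 * pi" "emeasure Qm (space Qm) = ennreal (2 * pi)"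
  by (simp_all add: measure_restrict_space emeasure_restrict_space space_restrict_space)

lemma finite_measure_Qm: "finite_measure Qm"
  using measure_Qm(2) by (intro finite_measureI) simp

lemma continuous_measurable_Qm:
  fixes g :: "real \<Rightarrow> 'b::euclidean_space"
  shows "continuous_on UNIV g \<Longrightarrow> g \<in> borel_measurable Qm"
  by (rule continuous_imp_measurable_on_sets_lebesgue) (auto intro: continuous_on_subset)

lemma integrable_Qm_bounded:
  fixes g :: "real \<Rightarrow> 'b::euclidean_space"
  assumes "g \<in> borel_measurable Qm" "\<And>x. norm (g x) \<le> B"
  shows "integrable Qm g"
  by (rule finite_measure.integrable_const_bound[OF finite_measure_Qm _ assms(1), of B]) (simp add: assms)

lemma norm_integral_Qm_le:
  fixes g :: "real \<Rightarrow> 'b::euclidean_space"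
  assumes "integrable Qm g" "\<And>x. norm (g x) \<le> B"
  shows "norm (integral\<^sup>L Qm g) \<le> 2 * pi * B"
proof -
  have "norm (integral\<^sup>L Qm g) \<le> (\<integral>x. norm (g x) \<partial>Qm)" by (rule integral_norm_bound)
  also have "\<dots> \<le> (\<integral>x. B \<partial>Qm)"
    by (intro integral_mono assms integrable_norm finite_measure.integrable_const[OF finite_measure_Qm])
  also have "\<dots> = 2 * pi * B" using measure_Qm by simp
  finally show ?thesis .
qed

lemma integrable_Qm_mult_cis:
  fixes f :: "real \<Rightarrow> complex"
  assumes "integrable Qm f"
  shows "integrable Qm (\<lambda>x. f x * cis (c * x))"
proof (rule Bochner_Integration.integrable_bound[OF assms])
  have [measurable]: "(\<lambda>x. cis (c * x)) \<in> borel_measurable Qm"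
    by (intro continuous_measurable_Qm continuous_intros)
  have [measurable]: "f \<in> borel_measurable Qm" using assms by auto
  show "(\<lambda>x. f x * cis (c * x)) \<in> borel_measurable Qm" by measurable
qed (simp add: norm_mult)

lemma fourier_coeff_cis:
  "fourier_coeff f k = 1 / (2 * of_real pi) * (\<integral>x. f x * cis (- real_of_int k * x) \<partial>Qm)"
proof -
  have "exp (- \<i> * of_int k * of_real x) = cis (- real_of_int k * x)" for x
    by (simp add: cis_conv_exp mult_ac)
  then show ?thesis
    unfolding fourier_coeff_def set_lebesgue_integral_def
    by (simp add: integral_restrict_space)
qed

lemma fourier_coeff_diff:
  assumes "integrable Qm f" "integrable Qm g"
  shows "fourier_coeff (\<lambda>x. f x - g x) k = fourier_coeff f k - fourier_coeff g k"
  unfolding fourier_coeff_cis left_diff_distrib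
    Bochner_Integration.integral_diff[OF integrable_Qm_mult_cis[OF assms(1)] integrable_Qm_mult_cis[OF assms(2)]]
  by (rule right_diff_distrib)

lemma fourier_coeff_bound:
  assumes "f \<in> borel_measurable Qm" "\<And>x. norm (f x) \<le> B"
  shows "cmod (fourier_coeff f k) \<le> B"
proof -
  have "cmod (\<integral>x. f x * cis (- real_of_int k * x) \<partial>Qm) \<le> 2 * pi * B"
    using integrable_Qm_bounded[OF assms] 
    by (intro norm_integral_Qm_le integrable_Qm_mult_cis) (auto simp: norm_mult assms)
  then show ?thesis by (simp add: fourier_coeff_cis norm_mult norm_divide field_simps)
qed

text \<open>Writing the entries as integrals of rank-one matrices \<open>f x * e\<^bsub>x\<^esub> e'\<^bsub>x\<^esub>\<^sup>*\<close> with unimodular vectors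
  shows that the trace norm is at most \<open>n\<close> times the normalised \<open>L\<^sup>1\<close> norm of \<open>f\<close>.\<close>

lemma alpha_toeplitz_pairing_bound:
  assumes f: "integrable Qm f"
    and Z: "\<And>u v :: nat \<Rightarrow> complex. (\<And>i. cmod (u i) = 1) \<Longrightarrow> (\<And>i. cmod (v i) = 1) \<Longrightarrow>
         cmod (\<Sum>r<n. \<Sum>c<n. u r * Z r c * v c) \<le> B"
  shows "cmod (\<Sum>r<n. \<Sum>c<n. fourier_coeff f (int r - int \<alpha> * int c) * Z r c)
    \<le> B * ((\<integral>x. cmod (f x) \<partial>Qm) / (2 * pi))"
proof -
  \<comment> \<open>The exponent -(r - \<alpha> c) x splits into a row phase and a column phase, so
    for each x the sum is a bilinear form of Z in two unimodular vectors.\<close>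
  define w where "w x = (\<Sum>r<n. \<Sum>c<n. cis (- real r * x) * Z r c * cis (real \<alpha> * real c * x))" for x
  have w: "cmod (w x) \<le> B" for x unfolding w_def by (rule Z) auto
  have "(\<Sum>r<n. \<Sum>c<n. fourier_coeff f (int r - int \<alpha> * int c) * Z r c) =
      1 / (2 * of_real pi) * (\<Sum>r<n. \<Sum>c<n. (\<integral>x. f x * cis (- real_of_int (int r - int \<alpha> * int c) * x) * Z r c \<partial>Qm))"
    by (simp only: fourier_coeff_cis integral_mult_left_zero sum_distrib_left) (simp only: mult.assoc)
  also have "(\<Sum>r<n. \<Sum>c<n. (\<integral>x. f x * cis (- real_of_int (int r - int \<alpha> * int c) * x) * Z r c \<partial>Qm)) =
      (\<integral>x. (\<Sum>r<n. \<Sum>c<n. f x * cis (- real_of_int (int r - int \<alpha> * int c) * x) * Z r c) \<partial>Qm)"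
    using integrable_mult_left[OF integrable_Qm_mult_cis[OF f]]
    by (simp only: Bochner_Integration.integral_sum Bochner_Integration.integrable_sum)
  also have "(\<lambda>x. (\<Sum>r<n. \<Sum>c<n. f x * cis (- real_of_int (int r - int \<alpha> * int c) * x) * Z r c)) = (\<lambda>x. f x * w x)"
    by (auto simp: w_def sum_distrib_left cis_mult mult_ac algebra_simps intro!: sum.cong ext)
  finally have eq: "(\<Sum>r<n. \<Sum>c<n. fourier_coeff f (int r - int \<alpha> * int c) * Z r c) =
      1 / (2 * of_real pi) * (\<integral>x. f x * w x \<partial>Qm)" .
  have "cmod (\<integral>x. f x * w x \<partial>Qm) \<le> (\<integral>x. cmod (f x) * B \<partial>Qm)"
  proof (rule Bochner_Integration.integral_norm_bound_integral)
    have [measurable]: "f \<in> borel_measurable Qm" using f by auto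
    have [measurable]: "w \<in> borel_measurable Qm" unfolding w_def
      by (intro continuous_measurable_Qm continuous_intros)
    show i: "integrable Qm (\<lambda>x. cmod (f x) * B)" using f by simp
    show "integrable Qm (\<lambda>x. f x * w x)"
      by (rule Bochner_Integration.integrable_bound[OF i])
        (use w in \<open>auto simp: norm_mult intro!: AE_I2 order_trans[OF mult_left_mono[OF w] abs_ge_self]\<close>)
    show "cmod (f x * w x) \<le> cmod (f x) * B" for x
      using w by (simp add: norm_mult mult_left_mono)
  qed
  also have "\<dots> = B * (\<integral>x. cmod (f x) \<partial>Qm)" by simp
  finally show ?thesis unfolding eq by (simp add: norm_mult norm_divide field_simps)
qed

lemma integral_cis_Qm: "(\<integral>x. cis (real_of_int k * x) \<partial>Qm) = (if k = 0 then 2 * of_real pi else 0)"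
proof (cases "k = 0")
  case True
  then show ?thesis using measure_Qm by (simp add: scaleR_conv_of_real)
next
  case False
  have int: "integrable Qm (\<lambda>x. cis (real_of_int k * x))"
    by (rule integrable_Qm_bounded[of _ 1]) (auto intro!: continuous_measurable_Qm continuous_intros)
  have "((\<lambda>x. cis (real_of_int k * x)) has_integral
     (cis (real_of_int k * pi) / (\<i> * of_int k) - cis (real_of_int k * (- pi)) / (\<i> * of_int k))) {-pi..pi}"
  proof (rule fundamental_theorem_of_calculus)
    fix x :: real
    have "((\<lambda>x. exp (\<i> * (of_int k * of_real x)) / (\<i> * of_int k)) has_vector_derivative
        (exp (\<i> * (of_int k * of_real x)))) (at x within {-pi..pi})"
      using False by (auto intro!: derivative_eq_intros has_vector_derivative_real_field simp: field_simps)
    then show "((\<lambda>x. cis (real_of_int k * x) / (\<i> * of_int k)) has_vector_derivative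
        cis (real_of_int k * x)) (at x within {-pi..pi})"
      by (simp add: cis_conv_exp)
  qed simp
  moreover have "cis (real_of_int k * pi) = cis (real_of_int k * (- pi))"
    by (simp add: complex_eq_iff)
      (metis Ints_of_int mult.commute sin_integer_2pi sin_int_2pin sin_npi_int sin_npi2 )
  ultimately have "((\<lambda>x. cis (real_of_int k * x)) has_integral 0) {-pi..pi}" by simp
  then have "integral {-pi<..<pi} (\<lambda>x. cis (real_of_int k * x)) = 0"
    by (simp add: integral_unique flip: integral_open_interval_real)
  then show ?thesis using False lebesgue_integral_eq_integral[OF int] by simp
qed

section \<open>Trigonometric polynomials and fibre averages\<close>

definition trig_sum :: "nat \<Rightarrow> (int \<Rightarrow> complex) \<Rightarrow> real \<Rightarrow> complex" where
  "trig_sum q a x = (\<Sum>k\<in>{-int q..int q}. a k * cis (real_of_int k * x))"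

lemma continuous_on_trig_sum [continuous_intros]:
  "continuous_on A f \<Longrightarrow> continuous_on A (\<lambda>x. trig_sum q a (f x))"
  unfolding trig_sum_def by (intro continuous_intros)

lemma integrable_trig_sum: "integrable Qm (trig_sum q a)"
proof -
  have "integrable Qm (\<lambda>x. (\<Sum>k\<in>{-int q..int q}. a k * cis (real_of_int k * x)))"
    by (intro Bochner_Integration.integrable_sum integrable_mult_right integrable_Qm_bounded[of _ 1])
      (auto intro!: continuous_measurable_Qm continuous_intros)
  then show ?thesis by (simp add: trig_sum_def[abs_def])
qed

lemma fourier_coeff_trig_sum:
  "fourier_coeff (trig_sum q a) k = (if k \<in> {-int q..int q} then a k else 0)"
proof -
  have int: "integrable Qm (\<lambda>x. cis (real_of_int j * x))" for j
    by (rule integrable_Qm_bounded[of _ 1]) (auto intro!: continuous_measurable_Qm continuous_intros)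
  have "(\<integral>x. trig_sum q a x * cis (- real_of_int k * x) \<partial>Qm) =
      (\<integral>x. (\<Sum>j\<in>{-int q..int q}. a j * cis (real_of_int (j - k) * x)) \<partial>Qm)"
  proof (intro Bochner_Integration.integral_cong refl)
    fix x
    have "cis (real_of_int j * x) * cis (- real_of_int k * x) = cis (real_of_int (j - k) * x)" for j
      by (simp add: cis_mult algebra_simps)
    then show "trig_sum q a x * cis (- real_of_int k * x) = (\<Sum>j\<in>{-int q..int q}. a j * cis (real_of_int (j - k) * x))"
      by (simp only: trig_sum_def sum_distrib_right mult.assoc)
  qed
  also have "\<dots> = (\<Sum>j\<in>{-int q..int q}. (\<integral>x. a j * cis (real_of_int (j - k) * x) \<partial>Qm))"
    by (rule Bochner_Integration.integral_sum) (intro integrable_mult_right int)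
  also have "\<dots> = (\<Sum>j\<in>{-int q..int q}. a j * (if j - k = 0 then 2 * of_real pi else 0))"
    by (simp only: integral_mult_right_zero integral_cis_Qm)
  also have "\<dots> = (\<Sum>j\<in>{-int q..int q}. if j = k then a j * (2 * of_real pi) else 0)"
    by (intro sum.cong) auto
  also have "\<dots> = (if k \<in> {-int q..int q} then a k * (2 * of_real pi) else 0)" 
    by (subst sum.delta) auto
  finally show ?thesis unfolding fourier_coeff_cis by simp
qed

lemma cis_add_2pi_multiple: "cis (real_of_int k * (x + 2 * pi * real_of_int m)) = cis (real_of_int k * x)"
proof -
  have "cis (2 * pi * real_of_int (k * m)) = 1" by (rule cis_multiple_2pi) simp
  then have "cis (real_of_int k * x + 2 * pi * real_of_int (k * m)) = cis (real_of_int k * x)"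
    by (simp add: cis_mult[symmetric])
  then show ?thesis by (simp add: algebra_simps)
qed

lemma periodic_ext_trig_sum: "periodic_ext (trig_sum q a) = trig_sum q a"
proof
  fix x
  define m where "m = \<lfloor>(x + pi) / \<bar>2 * pi\<bar>\<rfloor>"
  have "(x + pi) rmod (2 * pi) - pi = x + 2 * pi * real_of_int (- m)"
    by (simp add: rmod_def m_def)
  then show "periodic_ext (trig_sum q a) x = trig_sum q a x"
    unfolding periodic_ext_def trig_sum_def by (simp only: cis_add_2pi_multiple)
qed

text \<open>Up to a fixed phase the summands are the powers of the \<alpha>-th root of unity
  \<open>w\<close>, and their geometric sum cancels unless w = 1, that is, unless \<alpha> divides
  d. Averaging over the preimages of x under multiplication by \<alpha> is thus a frequency
  filter.\<close>

lemma mean_cis_fibre: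
  assumes "\<alpha> \<ge> 1"
  shows "(\<Sum>j<\<alpha>. cis (real_of_int d * ((x + 2 * pi * real j) / real \<alpha>))) / of_nat \<alpha> =
    (if int \<alpha> dvd d then cis (real_of_int (d div int \<alpha>) * x) else 0)"
proof -
  define w where "w = cis (2 * pi * (real_of_int d / real \<alpha>))"
  have "(\<Sum>j<\<alpha>. cis (real_of_int d * ((x + 2 * pi * real j) / real \<alpha>))) =
      cis (real_of_int d * x / real \<alpha>) * (\<Sum>j<\<alpha>. w ^ j)"
    unfolding sum_distrib_left
  proof (intro sum.cong refl)
    fix j
    have "cis (real_of_int d * x / real \<alpha>) * w ^ j =
        cis (real_of_int d * x / real \<alpha> + real j * (2 * pi * (real_of_int d / real \<alpha>)))"
      by (simp only: w_def Complex.DeMoivre cis_mult)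
    also have "real_of_int d * x / real \<alpha> + real j * (2 * pi * (real_of_int d / real \<alpha>)) =
        real_of_int d * ((x + 2 * pi * real j) / real \<alpha>)"
      using assms by (simp add: field_simps)
    finally show "cis (real_of_int d * ((x + 2 * pi * real j) / real \<alpha>)) =
        cis (real_of_int d * x / real \<alpha>) * w ^ j" by (rule sym)
  qed
  moreover have "w ^ \<alpha> = 1"
  proof -
    have "w ^ \<alpha> = cis (2 * pi * real_of_int d)" using assms by (simp add: w_def Complex.DeMoivre)
    then show ?thesis by (simp add: cis_multiple_2pi)
  qed
  moreover have "w = 1 \<longleftrightarrow> int \<alpha> dvd d"
  proof
    assume "w = 1"
    then obtain k where "2 * pi * (real_of_int d / real \<alpha>) = of_int k * (2 * pi)"
      unfolding w_def cis_eq_1_iff by auto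
    then have "real_of_int d = real_of_int (k * int \<alpha>)" using assms by (simp add: field_simps)
    then have "d = k * int \<alpha>" by linarith
    then show "int \<alpha> dvd d" by simp
  next
    assume "int \<alpha> dvd d"
    then obtain k where "d = int \<alpha> * k" by auto
    then show "w = 1" using assms by (simp add: w_def cis_multiple_2pi)
  qed
  moreover have "real_of_int d * x / real \<alpha> = real_of_int (d div int \<alpha>) * x" if "int \<alpha> dvd d"
    using that assms by (auto elim!: dvdE)
  ultimately show ?thesis using assms by (auto simp: geometric_sum)
qed

text \<open>|p|^2 is expanded into frequencies u - s, which are then filtered. The double sum is
  deliberately not collected by frequency: its terms can be matched one by one with the products of
  entries in a row of \<open>A^* A\<close>.\<close>

lemma hat_abs_sq_trig_sum:
  assumes "\<alpha> \<ge> 1"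
  shows "complex_of_real (hat_abs_sq (trig_sum q a) \<alpha> x) =
    (\<Sum>(s, u)\<in>{-int q..int q} \<times> {-int q..int q}.
       if int \<alpha> dvd u - s then cnj (a s) * a u * cis (real_of_int ((u - s) div int \<alpha>) * x) else 0)"
proof -
  let ?K = "{-int q..int q}"
  have sq: "complex_of_real ((cmod (trig_sum q a y))\<^sup>2) =
      (\<Sum>(s, u)\<in>?K \<times> ?K. cnj (a s) * a u * cis (real_of_int (u - s) * y))" for y
  proof -
    have "complex_of_real ((cmod (trig_sum q a y))\<^sup>2) = cnj (trig_sum q a y) * trig_sum q a y"
      by (simp only: complex_norm_square mult.commute)
    also have "\<dots> = (\<Sum>s\<in>?K. \<Sum>u\<in>?K. cnj (a s * cis (real_of_int s * y)) * (a u * cis (real_of_int u * y)))"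
      by (simp only: trig_sum_def cnj_sum sum_product)
    also have "\<dots> = (\<Sum>s\<in>?K. \<Sum>u\<in>?K. cnj (a s) * a u * cis (real_of_int (u - s) * y))"
    proof (intro sum.cong refl)
      fix s u
      have "cis (- (real_of_int s * y)) * cis (real_of_int u * y) = cis (real_of_int (u - s) * y)"
        by (simp add: cis_mult algebra_simps)
      then show "cnj (a s * cis (real_of_int s * y)) * (a u * cis (real_of_int u * y)) =
          cnj (a s) * a u * cis (real_of_int (u - s) * y)"
        by (simp add: cis_cnj mult_ac)
    qed
    finally show ?thesis by (simp only: sum.cartesian_product)
  qed
  have "complex_of_real (hat_abs_sq (trig_sum q a) \<alpha> x) =
      (\<Sum>j<\<alpha>. complex_of_real ((cmod (trig_sum q a ((x + 2 * pi * real j) / real \<alpha>)))\<^sup>2)) / of_nat \<alpha>"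
    by (simp add: hat_abs_sq_def periodic_ext_trig_sum)
  also have "\<dots> = (\<Sum>(s, u)\<in>?K \<times> ?K. \<Sum>j<\<alpha>. cnj (a s) * a u * cis (real_of_int (u - s) * ((x + 2 * pi * real j) / real \<alpha>))) / of_nat \<alpha>"
    unfolding sq by (subst sum.swap) (simp add: case_prod_unfold)
  also have "\<dots> = (\<Sum>(s, u)\<in>?K \<times> ?K. cnj (a s) * a u * ((\<Sum>j<\<alpha>. cis (real_of_int (u - s) * ((x + 2 * pi * real j) / real \<alpha>))) / of_nat \<alpha>))"
    unfolding sum_divide_distrib by (intro sum.cong refl) (simp add: case_prod_unfold sum_distrib_left sum_divide_distrib)
  also have "\<dots> = (\<Sum>(s, u)\<in>?K \<times> ?K. if int \<alpha> dvd u - s then cnj (a s) * a u * cis (real_of_int ((u - s) div int \<alpha>) * x) else 0)"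
    unfolding mean_cis_fibre[OF assms] by (intro sum.cong refl) auto
  finally show ?thesis .
qed

lemma hat_abs_sq_nonneg: "hat_abs_sq f \<alpha> x \<ge> 0"
  by (simp add: hat_abs_sq_def sum_nonneg)

lemma continuous_hat_abs_sq_trig_sum:
  "continuous_on A (hat_abs_sq (trig_sum q a) \<alpha>)"
  unfolding hat_abs_sq_def[abs_def] periodic_ext_trig_sum divide_inverse
  by (intro continuous_intros)

section \<open>Trigonometric polynomials: an approximate resolvent\<close>

text \<open>The defect D = 1 - (A^* A + t) S is supported on the bad rows, and R - S = R D. Each bad
  row j pairs column j of R, of norm at most 1 / t, with n entries of size at most 1 + C; by
  Cauchy-Schwarz this costs only sqrt n.\<close>

lemma resolvent_trace_approx:
  assumes R: "resolvent_mat n t A R" and t: "t > 0" and S: "S \<in> carrier_mat n n"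
    and bad: "\<And>c k. c < n \<Longrightarrow> k < n \<Longrightarrow> c \<notin> bad \<Longrightarrow>
      ((mat_adjoint A * A + of_real t \<cdot>\<^sub>m 1\<^sub>m n) * S) $$ (c, k) = (if c = k then 1 else 0)"
    and E: "\<And>c k. c < n \<Longrightarrow> k < n \<Longrightarrow>
      cmod (((mat_adjoint A * A + of_real t \<cdot>\<^sub>m 1\<^sub>m n) * S) $$ (c, k)) \<le> C"
    and fin: "finite bad" and C: "C \<ge> 0"
  shows "cmod (mtrace R - mtrace S) \<le> real (card bad) * (1 + C) * sqrt (real n) / t"
proof -
  define G where "G = mat_adjoint A * A + of_real t \<cdot>\<^sub>m 1\<^sub>m n"
  have c: "A \<in> carrier_mat n n" "R \<in> carrier_mat n n" "G \<in> carrier_mat n n"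
    using R by (auto simp: resolvent_mat_def G_def)
  have RG: "R * G = 1\<^sub>m n" using R by (simp add: resolvent_mat_def G_def)
  define D where "D = 1\<^sub>m n - G * S"
  have D: "D \<in> carrier_mat n n" unfolding D_def by (rule minus_carrier_mat[OF mult_carrier_mat[OF c(3) S]])
  have D0: "D $$ (i, k) = 0" if "i < n" "k < n" "i \<notin> bad" for i k
    using bad[OF that] that c S unfolding D_def G_def[symmetric] by simp
  have Db: "cmod (D $$ (i, k)) \<le> 1 + C" if "i < n" "k < n" for i k
  proof -
    have "D $$ (i, k) = (if i = k then 1 else 0) - (G * S) $$ (i, k)"
      using that c S unfolding D_def by simp
    then have "cmod (D $$ (i, k)) \<le> cmod (if i = k then 1 else 0) + cmod ((G * S) $$ (i, k))"
      by (simp only: norm_triangle_ineq4)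
    also have "\<dots> \<le> 1 + C" using E[OF that] unfolding G_def[symmetric] by (intro add_mono) auto
    finally show ?thesis .
  qed
  have "R * D = R - S"
    using c S RG unfolding D_def
    by (simp add: mult_minus_distrib_mat[of _ n n _ n] flip: assoc_mult_mat[of _ n n _ n _ n])
  then have "mtrace R - mtrace S = mtrace (R * D)"
    using c S by (simp add: mtrace_diff)
  also have "\<dots> = (\<Sum>j<n. \<Sum>i<n. R $$ (i, j) * D $$ (j, i))"
    by (subst sum.swap) (rule mtrace_mult[OF c(2) D])
  also have "\<dots> = (\<Sum>j\<in>{..<n} \<inter> bad. \<Sum>i<n. R $$ (i, j) * D $$ (j, i))"
    by (rule sum.mono_neutral_right) (auto simp: D0)
  finally have "cmod (mtrace R - mtrace S) \<le> (\<Sum>j\<in>{..<n} \<inter> bad. cmod (\<Sum>i<n. R $$ (i, j) * D $$ (j, i)))"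
    by (simp only: norm_sum)
  also have "\<dots> \<le> (\<Sum>j\<in>{..<n} \<inter> bad. (1 + C) * sqrt (real n) / t)"
  proof (rule sum_mono)
    fix j assume j: "j \<in> {..<n} \<inter> bad"
    \<comment> \<open>The j-th unit vector: the resolvent bound applied to it controls column j of
      R.\<close>
    define e where "e = (\<lambda>i. if i = j then 1 else 0 :: complex)"
    have "(\<Sum>i<n. (cmod (e i))\<^sup>2) = (\<Sum>i<n. if i = j then 1 else 0)"
      by (intro sum.cong) (auto simp: e_def)
    then have e1: "l2norm n e = 1" using j by (simp add: l2norm_def L2_set_def)
    have Re: "mapp R e i = R $$ (i, j)" if "i < n" for i
    proof -
      have "mapp R e i = (\<Sum>k<n. if k = j then R $$ (i, k) else 0)"
        unfolding mapp_def using c by (intro sum.cong) (auto simp: e_def)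
      then show ?thesis using j by simp
    qed
    have "cmod (\<Sum>i<n. R $$ (i, j) * D $$ (j, i)) = cmod (\<Sum>i<n. mapp R e i * D $$ (j, i))"
      using Re by simp
    also have "\<dots> \<le> l2norm n (mapp R e) * l2norm n (\<lambda>i. D $$ (j, i))" by (rule l2norm_Cauchy)
    also have "\<dots> \<le> (1 / t) * ((1 + C) * sqrt (real n))"
    proof (intro mult_mono)
      show "l2norm n (mapp R e) \<le> 1 / t" using resolvent_bound[OF R t, of e] e1 by simp
      have "l2norm n (\<lambda>i. D $$ (j, i)) \<le> L2_set (\<lambda>i. 1 + C) {..<n}"
        unfolding l2norm_def using Db j by (intro L2_set_mono) auto
      also have "\<dots> = (1 + C) * sqrt (real n)" using C by (simp add: L2_set_def real_sqrt_mult)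
      finally show "l2norm n (\<lambda>i. D $$ (j, i)) \<le> (1 + C) * sqrt (real n)" .
    qed (use t in auto)
    finally show "cmod (\<Sum>i<n. R $$ (i, j) * D $$ (j, i)) \<le> (1 + C) * sqrt (real n) / t" by simp
  qed
  also have "\<dots> \<le> real (card bad) * ((1 + C) * sqrt (real n) / t)"
    using fin C t by (simp add: mult_right_mono card_mono del: times_divide_eq_right)
  finally show ?thesis by (simp add: mult.assoc)
qed

text \<open>Each coefficient is met at most once. It serves both the index r - m down a column of A
  and the index m - \<alpha> k along a row.\<close>

lemma sum_norm_inj_le:
  fixes a :: "int \<Rightarrow> complex"
  assumes "inj_on \<phi> K" "finite K" "finite L"
  shows "(\<Sum>k\<in>K. cmod (if \<phi> k \<in> L then a (\<phi> k) else 0)) \<le> (\<Sum>l\<in>L. cmod (a l))"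
proof -
  have "(\<Sum>k\<in>K. cmod (if \<phi> k \<in> L then a (\<phi> k) else 0)) = (\<Sum>l\<in>\<phi> ` K. cmod (if l \<in> L then a l else 0))"
    by (simp add: sum.reindex[OF assms(1)])
  also have "\<dots> = (\<Sum>l\<in>\<phi> ` K \<inter> L. cmod (a l))"
    by (intro sum.mono_neutral_cong_right) (use assms in auto)
  also have "\<dots> \<le> (\<Sum>l\<in>L. cmod (a l))" using assms by (intro sum_mono2) auto
  finally show ?thesis .
qed

section \<open>The approximate resolvent of a fixed polynomial symbol\<close>

locale trig_symbol =
  fixes q :: nat and a :: "int \<Rightarrow> complex" and \<alpha> :: nat and t :: real
  assumes \<alpha>: "\<alpha> \<ge> 1" and t: "t > 0"
begin

definition b :: "int \<Rightarrow> complex" where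
  "b k = (if k \<in> {-int q..int q} then a k else 0)"

definition h :: "real \<Rightarrow> real" where
  "h = hat_abs_sq (trig_sum q a) \<alpha>"

definition \<gamma> :: "int \<Rightarrow> complex" where
  "\<gamma> = fourier_coeff (\<lambda>x. of_real (1 / (h x + t)))"

definition S :: "nat \<Rightarrow> complex Matrix.mat" where
  "S n = Matrix.mat n n (\<lambda>(k, l). if k < n div \<alpha> \<and> l < n div \<alpha> then \<gamma> (int k - int l)
     else if k = l then of_real (1 / t) else 0)"

abbreviation A :: "nat \<Rightarrow> complex Matrix.mat" where
  "A \<equiv> alpha_toeplitz (trig_sum q a) \<alpha>"

text \<open>The Wiener algebra norm of the polynomial; it dominates all absolute row and column sums
  of A, uniformly in n.\<close>

definition norm1 :: real where
  "norm1 = (\<Sum>l\<in>{-int q..int q}. cmod (a l))"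

lemma A_carrier [simp]: "A n \<in> carrier_mat n n"
  by (simp add: alpha_toeplitz_def)

lemma S_carrier [simp]: "S n \<in> carrier_mat n n"
  by (simp add: S_def)

lemma A_index: "r < n \<Longrightarrow> c < n \<Longrightarrow> A n $$ (r, c) = b (int r - int \<alpha> * int c)"
  by (simp add: alpha_toeplitz_def fourier_coeff_trig_sum b_def)

lemma inverse_symbol_measurable: "(\<lambda>x. complex_of_real (1 / (h x + t))) \<in> borel_measurable Qm"
  using t hat_abs_sq_nonneg[of "trig_sum q a" \<alpha>] unfolding h_def
  by (intro continuous_measurable_Qm continuous_intros continuous_hat_abs_sq_trig_sum) 
    (metis add_nonneg_pos less_irrefl)

lemma inverse_symbol_bound: "norm (complex_of_real (1 / (h x + t))) \<le> 1 / t"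
  using t hat_abs_sq_nonneg[of "trig_sum q a" \<alpha> x] unfolding h_def norm_of_real
  by (simp add: frac_le)

lemma \<gamma>_bound: "cmod (\<gamma> k) \<le> 1 / t"
  unfolding \<gamma>_def by (rule fourier_coeff_bound[OF inverse_symbol_measurable inverse_symbol_bound])

lemma norm1_nonneg: "norm1 \<ge> 0"
  by (simp add: norm1_def sum_nonneg)

lemma gram_index:
  assumes "c < n" "k < n"
  shows "(mat_adjoint (A n) * A n) $$ (c, k) =
    (\<Sum>r<n. cnj (b (int r - int \<alpha> * int c)) * b (int r - int \<alpha> * int k))"
  using assms carrier_matD[OF A_carrier[of n]]
  by (auto simp: index_mult_mat_sum[OF mat_adjoint_carrier[OF A_carrier] A_carrier]
      index_mat_adjoint A_index simp del: index_mult_mat(1) intro!: sum.cong)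

lemma sum_b_rows: "(\<Sum>r<n. cmod (b (int r - m))) \<le> norm1"
  unfolding b_def norm1_def by (rule sum_norm_inj_le) (auto simp: inj_on_def)

lemma sum_b_columns: "(\<Sum>k<n. cmod (b (m - int \<alpha> * int k))) \<le> norm1"
  unfolding b_def norm1_def by (rule sum_norm_inj_le) (use \<alpha> in \<open>auto simp: inj_on_def\<close>)

text \<open>A Schur test: first the row sums and then the column sums of A are bounded by
  \<open>norm1\<close>. Independence of n is what keeps the entries of the defect bounded.\<close>

lemma sum_gram_row:
  assumes "c < n"
  shows "(\<Sum>k<n. cmod ((mat_adjoint (A n) * A n) $$ (c, k))) \<le> norm1\<^sup>2"
proof -
  have "(\<Sum>k<n. cmod ((mat_adjoint (A n) * A n) $$ (c, k))) \<le>
      (\<Sum>k<n. \<Sum>r<n. cmod (b (int r - int \<alpha> * int c)) * cmod (b (int r - int \<alpha> * int k)))"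
    using assms by (intro sum_mono) (auto simp: gram_index norm_mult intro!: order_trans[OF norm_sum] simp del: index_mult_mat(1))
  also have "\<dots> = (\<Sum>r<n. cmod (b (int r - int \<alpha> * int c)) * (\<Sum>k<n. cmod (b (int r - int \<alpha> * int k))))"
    by (subst sum.swap) (simp add: sum_distrib_left)
  also have "\<dots> \<le> (\<Sum>r<n. cmod (b (int r - int \<alpha> * int c)) * norm1)"
    by (intro sum_mono mult_left_mono sum_b_columns) auto
  also have "\<dots> = (\<Sum>r<n. cmod (b (int r - int \<alpha> * int c))) * norm1"
    by (simp add: sum_distrib_right)
  also have "\<dots> \<le> norm1 * norm1"
    by (intro mult_right_mono sum_b_rows norm1_nonneg)
  finally show ?thesis by (simp add: power2_eq_square)
qed

lemma S_bound: "k < n \<Longrightarrow> l < n \<Longrightarrow> cmod (S n $$ (k, l)) \<le> 1 / t"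
  using \<gamma>_bound t by (auto simp: S_def norm_divide)

lemma shifted_gram_index:
  assumes "c < n" "l < n"
  shows "((mat_adjoint (A n) * A n + of_real t \<cdot>\<^sub>m 1\<^sub>m n) * S n) $$ (c, l) =
    (\<Sum>k<n. (mat_adjoint (A n) * A n) $$ (c, k) * S n $$ (k, l)) + of_real t * S n $$ (c, l)"
proof -
  have M: "mat_adjoint (A n) * A n \<in> carrier_mat n n" by simp
  then have G: "mat_adjoint (A n) * A n + of_real t \<cdot>\<^sub>m 1\<^sub>m n \<in> carrier_mat n n" by simp
  have "((mat_adjoint (A n) * A n + of_real t \<cdot>\<^sub>m 1\<^sub>m n) * S n) $$ (c, l) =
      (\<Sum>k<n. (mat_adjoint (A n) * A n) $$ (c, k) * S n $$ (k, l) + (if k = c then of_real t * S n $$ (k, l) else 0))"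
    unfolding index_mult_mat_sum[OF G S_carrier assms]
  proof (rule sum.cong[OF refl])
    fix k assume "k \<in> {..<n}"
    then have "(mat_adjoint (A n) * A n + of_real t \<cdot>\<^sub>m 1\<^sub>m n) $$ (c, k) =
        (mat_adjoint (A n) * A n) $$ (c, k) + (if k = c then of_real t else 0)"
      using assms M by (auto simp del: index_mult_mat(1))
    then show "(mat_adjoint (A n) * A n + of_real t \<cdot>\<^sub>m 1\<^sub>m n) $$ (c, k) * S n $$ (k, l) =
        (mat_adjoint (A n) * A n) $$ (c, k) * S n $$ (k, l) + (if k = c then of_real t * S n $$ (k, l) else 0)"
      by (simp only: distrib_right) simp
  qed
  then show ?thesis using assms by (simp add: sum.distrib del: index_mult_mat(1))
qed

lemma shifted_gram_bound:
  assumes "c < n" "l < n"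
  shows "cmod (((mat_adjoint (A n) * A n + of_real t \<cdot>\<^sub>m 1\<^sub>m n) * S n) $$ (c, l)) \<le> norm1\<^sup>2 / t + 1"
proof -
  have "cmod (\<Sum>k<n. (mat_adjoint (A n) * A n) $$ (c, k) * S n $$ (k, l)) \<le>
      (\<Sum>k<n. cmod ((mat_adjoint (A n) * A n) $$ (c, k)) * (1 / t))"
    by (rule order_trans[OF norm_sum], intro sum_mono) (use assms in \<open>auto simp: norm_mult S_bound simp del: times_divide_eq_right index_mult_mat(1) intro!: mult_left_mono\<close>)
  also have "\<dots> = (\<Sum>k<n. cmod ((mat_adjoint (A n) * A n) $$ (c, k))) * (1 / t)"
    by (simp only: sum_distrib_right)
  also have "\<dots> \<le> norm1\<^sup>2 * (1 / t)"
    using t by (intro mult_right_mono sum_gram_row assms) auto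
  finally have 1: "cmod (\<Sum>k<n. (mat_adjoint (A n) * A n) $$ (c, k) * S n $$ (k, l)) \<le> norm1\<^sup>2 / t" by simp
  have "t * cmod (S n $$ (c, l)) \<le> t * (1 / t)"
    using t assms by (intro mult_left_mono S_bound) auto
  then have 2: "cmod (of_real t * S n $$ (c, l)) \<le> 1" using t by (simp add: norm_mult)
  show ?thesis unfolding shifted_gram_index[OF assms]
    by (rule order_trans[OF norm_triangle_ineq]) (use 1 2 in linarith)
qed

text \<open>One more than the largest difference of two indices in the window. It bounds the
  bandwidth of \<open>A^* A\<close> and is the margin at which the ends of the matrix stop being
  felt.\<close>

definition L :: nat where "L = 2 * q + 1"

text \<open>Column c of A is already zero: r - \<alpha> c < -q for every row r < n.\<close>

lemma gram_row_vanishes: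
  assumes "c < n" "k < n" "n div \<alpha> + L \<le> c"
  shows "(mat_adjoint (A n) * A n) $$ (c, k) = 0"
proof -
  have "b (int r - int \<alpha> * int c) = 0" if "r < n" for r
  proof -
    \<comment> \<open>Of \<alpha> L = \<alpha> 2 q + \<alpha>, the summand \<alpha> absorbs the
      remainder of the division and the rest pays for the window.\<close>
    have "n < \<alpha> * (n div \<alpha>) + \<alpha>" using dividend_less_times_div[of \<alpha> n] \<alpha> by simp
    moreover have "\<alpha> * (n div \<alpha> + L) \<le> \<alpha> * c" using assms by (intro mult_left_mono) auto
    moreover have "\<alpha> * L = \<alpha> * (2 * q) + \<alpha>" by (simp add: L_def algebra_simps)
    moreover have "1 * (2 * q) \<le> \<alpha> * (2 * q)" using \<alpha> by (intro mult_right_mono) auto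
    ultimately have "n + 2 * q < \<alpha> * c" unfolding add_mult_distrib2 by linarith
    then have "int n + 2 * int q < int \<alpha> * int c" by (metis of_nat_add of_nat_less_iff of_nat_mult of_nat_numeral)
    then show ?thesis using that by (auto simp: b_def)
  qed
  then show ?thesis using assms by (simp add: gram_index del: index_mult_mat(1))
qed

text \<open>A nonzero entry needs a row r within distance q of both \<alpha> c and \<alpha>
  k.\<close>

lemma gram_band:
  assumes "c < n" "k < n" "(mat_adjoint (A n) * A n) $$ (c, k) \<noteq> 0"
  shows "\<bar>int c - int k\<bar> < int L"
proof -
  from assms have "(\<Sum>r<n. cnj (b (int r - int \<alpha> * int c)) * b (int r - int \<alpha> * int k)) \<noteq> 0"
    by (simp add: gram_index del: index_mult_mat(1))
  then obtain r where "cnj (b (int r - int \<alpha> * int c)) * b (int r - int \<alpha> * int k) \<noteq> 0"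
    by (meson sum.neutral)
  then have "\<bar>int r - int \<alpha> * int c\<bar> \<le> int q" "\<bar>int r - int \<alpha> * int k\<bar> \<le> int q"
    by (auto simp: b_def split: if_splits)
  then have "\<bar>int \<alpha> * (int c - int k)\<bar> \<le> 2 * int q" unfolding right_diff_distrib by linarith
  moreover have "1 * \<bar>int c - int k\<bar> \<le> int \<alpha> * \<bar>int c - int k\<bar>"
    using \<alpha> by (intro mult_right_mono) auto
  ultimately show ?thesis by (simp add: L_def abs_mult)
qed

text \<open>In an interior row nothing is cut off: every pair (s, u) of window indices with \<alpha>
  dividing u - s arises as (r - \<alpha> c, r - \<alpha> k) for exactly one admissible (k, r). So
  the row lists the Fourier coefficients of h without truncation.\<close>

lemma gram_row_symbol:
  assumes c: "L \<le> c" "c + L \<le> n div \<alpha>"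
  shows "(\<Sum>k<n div \<alpha>. (mat_adjoint (A n) * A n) $$ (c, k) * cis (real_of_int (int c - int k) * x)) = of_real (h x)"
proof -
  let ?m = "n div \<alpha>" and ?K = "{-int q..int q}"
  have mn: "?m \<le> n" "\<alpha> * ?m \<le> n" by auto
  define F where "F = (\<lambda>(k, r). cnj (b (int r - int \<alpha> * int c)) * b (int r - int \<alpha> * int k) *
    cis (real_of_int (int c - int k) * x))"
  define H where "H = (\<lambda>(s, u). if int \<alpha> dvd u - s
    then cnj (b s) * b u * cis (real_of_int ((u - s) div int \<alpha>) * x) else 0)"
  \<comment> \<open>Solving s = r - \<alpha> c and u = r - \<alpha> k for r and k. The conversion
    \<open>nat\<close> is harmless, since both values are shown nonnegative for the nonzero
    terms.\<close>
  define i where "i = (\<lambda>(s :: int, u :: int). (nat (int c - (u - s) div int \<alpha>), nat (s + int \<alpha> * int c)))"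
  define j where "j = (\<lambda>(k :: nat, r :: nat). (int r - int \<alpha> * int c, int r - int \<alpha> * int k))"
  have d: "(int r - int \<alpha> * int k) - (int r - int \<alpha> * int c) = int \<alpha> * (int c - int k)" for k r
    by (simp add: algebra_simps)
  have HF: "H (j p) = F p" for p
    using \<alpha> by (cases p) (simp add: H_def F_def j_def d)
  have "(\<Sum>k<?m. (mat_adjoint (A n) * A n) $$ (c, k) * cis (real_of_int (int c - int k) * x)) =
      (\<Sum>k<?m. \<Sum>r<n. F (k, r))"
  proof (rule sum.cong[OF refl])
    fix k assume "k \<in> {..<?m}"
    then have "k < ?m" by simp
    then have "c < n" "k < n" using c mn(1) unfolding L_def by linarith+
    then show "(mat_adjoint (A n) * A n) $$ (c, k) * cis (real_of_int (int c - int k) * x) = (\<Sum>r<n. F (k, r))"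
      by (simp only: gram_index F_def sum_distrib_right split)
  qed
  also have "\<dots> = sum F ({..<?m} \<times> {..<n})"
    by (simp add: sum.cartesian_product)
  \<comment> \<open>The index sets differ in size; only the nonzero terms correspond to each
    other.\<close>
  also have "\<dots> = sum H (?K \<times> ?K)"
  proof (rule sum.reindex_bij_witness_not_neutral[where i = i and j = j and
        S' = "{p \<in> {..<?m} \<times> {..<n}. F p = 0}" and T' = "{p \<in> ?K \<times> ?K. H p = 0}"])
    fix p assume p: "p \<in> {..<?m} \<times> {..<n} - {p \<in> {..<?m} \<times> {..<n}. F p = 0}"
    obtain k r where kr: "p = (k, r)" by fastforce
    from p kr have nz: "F (k, r) \<noteq> 0" and lt: "k < ?m" "r < n" by auto
    from nz have in_K: "int r - int \<alpha> * int c \<in> ?K" "int r - int \<alpha> * int k \<in> ?K"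
      by (auto simp: F_def b_def split: if_splits)
    show "i (j p) = p" unfolding kr j_def i_def using \<alpha> by (simp add: d)
    show "j p \<in> ?K \<times> ?K - {p \<in> ?K \<times> ?K. H p = 0}"
      using in_K nz HF[of p] unfolding kr by (auto simp: j_def)
  next
    fix p assume p: "p \<in> ?K \<times> ?K - {p \<in> ?K \<times> ?K. H p = 0}"
    obtain s u where su: "p = (s, u)" by fastforce
    from p su have nz: "H (s, u) \<noteq> 0" and in_K: "s \<in> ?K" "u \<in> ?K" by auto
    from nz have "int \<alpha> dvd u - s" by (auto simp: H_def split: if_splits)
    then obtain d where d: "u - s = int \<alpha> * d" by auto
    have dd: "(u - s) div int \<alpha> = d" using d \<alpha> by simp
    have "\<bar>int \<alpha> * d\<bar> \<le> 2 * int q" using in_K unfolding d[symmetric] by auto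
    moreover have "1 * \<bar>d\<bar> \<le> int \<alpha> * \<bar>d\<bar>" using \<alpha> by (intro mult_right_mono) auto
    ultimately have dL: "\<bar>d\<bar> < int L" by (simp add: L_def abs_mult)
    have k: "0 \<le> int c - d" "int c - d < int ?m" using dL c by linarith+
    \<comment> \<open>Both ends of the range of r: \<alpha> c is at least \<alpha> L > q, and
      \<alpha> c is at most n - \<alpha> L, so a shift by s stays inside.\<close>
    have "int \<alpha> * int L \<le> int \<alpha> * int c" using c by (intro mult_left_mono) auto
    moreover have "1 * int L \<le> int \<alpha> * int L" using \<alpha> by (intro mult_right_mono) auto
    moreover have "int \<alpha> * int (c + L) \<le> int \<alpha> * int ?m" using c by (intro mult_left_mono) (simp_all only: of_nat_le_iff of_nat_0_le_iff)
    moreover have "int \<alpha> * int ?m \<le> int n" using mn(2) by (metis of_nat_le_iff of_nat_mult)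
    moreover have "int L = 2 * int q + 1" "- int q \<le> s" "s \<le> int q" using in_K by (auto simp: L_def)
    ultimately have r: "0 \<le> s + int \<alpha> * int c" "s + int \<alpha> * int c < int n"
      unfolding of_nat_add distrib_left by linarith+
    have kk: "int (nat (int c - (u - s) div int \<alpha>)) = int c - d" using k dd by simp
    have rr: "int (nat (s + int \<alpha> * int c)) = s + int \<alpha> * int c" using r by simp
    show ji: "j (i p) = p" unfolding su i_def j_def 
      by (simp only: split kk rr) (use d in \<open>simp add: algebra_simps\<close>)
    have "F (i p) = H p" unfolding su i_def F_def
      by (simp only: split kk rr) (use in_K d dd in \<open>simp add: H_def b_def algebra_simps\<close>)
    then show "i p \<in> {..<?m} \<times> {..<n} - {p \<in> {..<?m} \<times> {..<n}. F p = 0}"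
      using k r nz dd unfolding su i_def by auto
  qed (auto simp: HF)
  also have "\<dots> = of_real (h x)"
    unfolding h_def hat_abs_sq_trig_sum[OF \<alpha>] H_def by (intro sum.cong refl) (auto simp: b_def)
  finally show ?thesis .
qed

text \<open>In the far rows only t * (1 / t) on the diagonal remains. In the interior rows the band
  keeps the sum inside the Toeplitz block, where it becomes a convolution of Fourier
  coefficients.\<close>

lemma shifted_gram_good_row:
  assumes "c < n" "l < n" and good: "L \<le> c \<and> c + L \<le> n div \<alpha> \<or> n div \<alpha> + L \<le> c"
  shows "((mat_adjoint (A n) * A n + of_real t \<cdot>\<^sub>m 1\<^sub>m n) * S n) $$ (c, l) = (if c = l then 1 else 0)"
proof -
  let ?m = "n div \<alpha>" and ?M = "mat_adjoint (A n) * A n"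
  have mn: "?m \<le> n" by simp
  have Lpos: "L > 0" by (simp add: L_def)
  show ?thesis
  proof (cases "?m + L \<le> c")
    case True
    then show ?thesis
      using t assms(1,2) unfolding shifted_gram_index[OF assms(1,2)]
      by (simp add: gram_row_vanishes S_def del: index_mult_mat(1))
  next
    case False
    with good have c: "L \<le> c" "c + L \<le> ?m" by auto
    then have cm: "c < ?m" using Lpos by linarith
    show ?thesis
    proof (cases "l < ?m")
      \<comment> \<open>Column l of S lives outside the block, while the band of row c ends inside
        it.\<close>
      case l: False
      have "?M $$ (c, k) * S n $$ (k, l) = 0" if "k < n" for k
      proof (cases "k < ?m")
        case True
        then show ?thesis using l that assms by (simp add: S_def del: index_mult_mat(1))
      next
        case False
        then have "\<not> \<bar>int c - int k\<bar> < int L" using c by linarith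
        then have "?M $$ (c, k) = 0" using gram_band[OF assms(1) that] by blast
        then show ?thesis by (simp only: mult_zero_left)
      qed
      then have "(\<Sum>k<n. ?M $$ (c, k) * S n $$ (k, l)) = 0" by (intro sum.neutral) (simp del: index_mult_mat(1))
      then show ?thesis
        using l cm assms(1,2) unfolding shifted_gram_index[OF assms(1,2)] by (simp add: S_def)
    next
      case l: True
      let ?g = "\<lambda>x. complex_of_real (1 / (h x + t))"
      have int: "integrable Qm (\<lambda>x. z * (?g x * cis (c * x)))" for c z
        by (intro integrable_mult_right integrable_Qm_mult_cis integrable_Qm_bounded[OF inverse_symbol_measurable inverse_symbol_bound])
      have "(\<Sum>k<n. ?M $$ (c, k) * S n $$ (k, l)) = (\<Sum>k<?m. ?M $$ (c, k) * \<gamma> (int k - int l))"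
      proof (rule sum.mono_neutral_cong_right)
        have Sk: "S n $$ (k, l) = (if k < ?m then \<gamma> (int k - int l) else 0)" if "k < n" for k
          using that l assms(1,2) by (auto simp: S_def)
        show "\<forall>k\<in>{..<n} - {..<?m}. ?M $$ (c, k) * S n $$ (k, l) = 0"
        proof
          fix k assume "k \<in> {..<n} - {..<?m}"
          then have "S n $$ (k, l) = 0" using Sk[of k] by auto
          then show "?M $$ (c, k) * S n $$ (k, l) = 0" by (simp only: mult_zero_right)
        qed
        show "?M $$ (c, k) * S n $$ (k, l) = ?M $$ (c, k) * \<gamma> (int k - int l)" if "k \<in> {..<?m}" for k
        proof -
          have "k < n" using that less_le_trans[OF _ mn, of k] by auto
          then have "S n $$ (k, l) = \<gamma> (int k - int l)" using Sk[of k] that by auto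
          then show ?thesis by (simp only:)
        qed
      qed (use mn in auto)
      moreover have "S n $$ (c, l) = \<gamma> (int c - int l)"
        using cm l assms by (simp add: S_def)
      \<comment> \<open>The convolution gives the Fourier coefficient of (h + t) * (1 / (h + t)) = 1
        at c - l.\<close>
      moreover have "(\<Sum>k<?m. ?M $$ (c, k) * \<gamma> (int k - int l)) + of_real t * \<gamma> (int c - int l) =
          1 / (2 * of_real pi) * (\<integral>x. cis (- real_of_int (int c - int l) * x) \<partial>Qm)"
      proof -
        have "(\<Sum>k<?m. ?M $$ (c, k) * \<gamma> (int k - int l)) + of_real t * \<gamma> (int c - int l) =
          1 / (2 * of_real pi) * ((\<Sum>k<?m. (\<integral>x. ?M $$ (c, k) * (?g x * cis (- real_of_int (int k - int l) * x)) \<partial>Qm)) +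
            (\<integral>x. of_real t * (?g x * cis (- real_of_int (int c - int l) * x)) \<partial>Qm))"
          unfolding \<gamma>_def fourier_coeff_cis integral_mult_right_zero distrib_left sum_distrib_left
          by (intro arg_cong2[of _ _ _ _ "(+)"] sum.cong refl) (simp_all only: mult_ac)
        also have "(\<Sum>k<?m. (\<integral>x. ?M $$ (c, k) * (?g x * cis (- real_of_int (int k - int l) * x)) \<partial>Qm)) +
            (\<integral>x. of_real t * (?g x * cis (- real_of_int (int c - int l) * x)) \<partial>Qm) =
           (\<integral>x. (\<Sum>k<?m. ?M $$ (c, k) * (?g x * cis (- real_of_int (int k - int l) * x))) + 
             of_real t * (?g x * cis (- real_of_int (int c - int l) * x)) \<partial>Qm)"
          by (simp only: Bochner_Integration.integral_add Bochner_Integration.integral_sum Bochner_Integration.integrable_sum int)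
        also have "\<dots> = (\<integral>x. cis (- real_of_int (int c - int l) * x) \<partial>Qm)"
        proof (intro Bochner_Integration.integral_cong refl)
          fix x
          let ?e = "cis (- real_of_int (int c - int l) * x)"
          have ac: "y * (g * (w * e)) = (y * w) * (g * e)" for y g w e :: complex
            by (simp add: mult_ac)
          have e: "cis (- real_of_int (int k - int l) * x) = cis (real_of_int (int c - int k) * x) * ?e" for k
            by (simp add: cis_mult algebra_simps)
          have "(\<Sum>k<?m. ?M $$ (c, k) * (?g x * cis (- real_of_int (int k - int l) * x))) =
              (\<Sum>k<?m. ?M $$ (c, k) * cis (real_of_int (int c - int k) * x)) * (?g x * ?e)"
            unfolding sum_distrib_right ac[symmetric] by (intro sum.cong refl arg_cong2[of _ _ _ _ "(*)"] e)
          then have "(\<Sum>k<?m. ?M $$ (c, k) * (?g x * cis (- real_of_int (int k - int l) * x))) = of_real (h x) * (?g x * ?e)"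
            by (simp only: gram_row_symbol[OF c])
          then have "(\<Sum>k<?m. ?M $$ (c, k) * (?g x * cis (- real_of_int (int k - int l) * x))) + of_real t * (?g x * ?e) =
              of_real ((h x + t) * (1 / (h x + t))) * ?e"
            by (simp only: of_real_add of_real_mult distrib_right mult.assoc)
          moreover have "h x + t \<noteq> 0" using t hat_abs_sq_nonneg[of "trig_sum q a" \<alpha> x] by (simp add: h_def)
          ultimately show "(\<Sum>k<?m. ?M $$ (c, k) * (?g x * cis (- real_of_int (int k - int l) * x))) + of_real t * (?g x * ?e) = ?e"
            by simp
        qed
        finally show ?thesis .
      qed
      ultimately have "((?M + of_real t \<cdot>\<^sub>m 1\<^sub>m n) * S n) $$ (c, l) =
          1 / (2 * of_real pi) * (\<integral>x. cis (- real_of_int (int c - int l) * x) \<partial>Qm)"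
        by (simp only: shifted_gram_index[OF assms(1,2)])
      also have "\<dots> = (if c = l then 1 else 0)"
        using integral_cis_Qm[of "int l - int c"] by simp
      finally show ?thesis .
    qed
  qed
qed

lemma trace_S: "mtrace (S n) = of_nat (n div \<alpha>) * \<gamma> 0 + of_nat (n - n div \<alpha>) * of_real (1 / t)"
proof -
  let ?m = "n div \<alpha>"
  have "mtrace (S n) = (\<Sum>i<n. if i < ?m then \<gamma> 0 else of_real (1 / t))"
    unfolding mtrace_def by (rule sum.cong) (auto simp: S_def)
  also have "\<dots> = (\<Sum>i\<in>{..<?m} \<union> {?m..<n}. if i < ?m then \<gamma> 0 else of_real (1 / t))"
    by (intro sum.cong) (auto intro: less_le_trans[OF _ div_le_dividend])
  also have "\<dots> = (\<Sum>i<?m. \<gamma> 0) + (\<Sum>i\<in>{?m..<n}. of_real (1 / t))"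
    by (subst sum.union_disjoint) auto
  finally show ?thesis by simp
qed

lemma trace_resolvent_bound:
  assumes "resolvent_mat n t (A n) R"
  shows "cmod (mtrace R - mtrace (S n)) \<le> real (3 * L) * (2 + norm1\<^sup>2 / t) * sqrt (real n) / t"
proof -
  let ?m = "n div \<alpha>"
  \<comment> \<open>The first L rows and a window of 2 L rows around n div \<alpha>. If n div
    \<alpha> < L, the truncated subtraction makes the window start at 0, and all rows below n div
    \<alpha> + L are bad; the count 3 L still holds.\<close>
  define bad where "bad = {..<L} \<union> {?m - L..<?m + L}"
  have "card bad \<le> L + (?m + L - (?m - L))"
    unfolding bad_def by (rule order_trans[OF card_Un_le]) simp
  also have "\<dots> \<le> 3 * L" by simp
  finally have cb: "card bad \<le> 3 * L" .
  have good: "L \<le> c \<and> c + L \<le> ?m \<or> ?m + L \<le> c" if "c \<notin> bad" for c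
    using that unfolding bad_def by (cases "L \<le> ?m") (auto simp: not_less)
  have "cmod (mtrace R - mtrace (S n)) \<le> real (card bad) * (1 + (norm1\<^sup>2 / t + 1)) * sqrt (real n) / t"
  proof (rule resolvent_trace_approx[OF assms t S_carrier])
    show "((mat_adjoint (A n) * A n + of_real t \<cdot>\<^sub>m 1\<^sub>m n) * S n) $$ (c, k) = (if c = k then 1 else 0)"
      if "c < n" "k < n" "c \<notin> bad" for c k
      using shifted_gram_good_row[OF that(1,2) good[OF that(3)]] .
    show "0 \<le> norm1\<^sup>2 / t + 1" using t by simp
  qed (auto simp: bad_def intro: shifted_gram_bound simp del: index_mult_mat(1))
  also have "\<dots> \<le> real (3 * L) * (1 + (norm1\<^sup>2 / t + 1)) * sqrt (real n) / t"
    using cb t by (intro divide_right_mono mult_right_mono) (auto simp del: of_nat_mult)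
  finally show ?thesis by (simp add: add_ac)
qed

lemma div_over_tendsto: "(\<lambda>n. real (n div \<alpha>) / real n) \<longlonglongrightarrow> 1 / real \<alpha>"
proof (rule tendsto_sandwich[where f = "\<lambda>n. 1 / real \<alpha> - 1 / real n" and h = "\<lambda>n. 1 / real \<alpha>"])
  have *: "real (n div \<alpha>) \<le> real n / real \<alpha>" "real n / real \<alpha> - 1 \<le> real (n div \<alpha>)" for n
  proof -
    have "real n = real \<alpha> * real (n div \<alpha>) + real (n mod \<alpha>)"
      by (metis mult_div_mod_eq of_nat_add of_nat_mult)
    moreover have "real (n mod \<alpha>) < real \<alpha>" using \<alpha> by simp
    ultimately show "real (n div \<alpha>) \<le> real n / real \<alpha>" "real n / real \<alpha> - 1 \<le> real (n div \<alpha>)"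
      using \<alpha> by (simp_all add: field_simps)
  qed
  show "\<forall>\<^sub>F n in sequentially. 1 / real \<alpha> - 1 / real n \<le> real (n div \<alpha>) / real n"
    using eventually_gt_at_top[of 0]
  proof eventually_elim
    case (elim n)
    have "(real n / real \<alpha> - 1) / real n \<le> real (n div \<alpha>) / real n"
      using * by (intro divide_right_mono) auto
    then show ?case using elim by (simp add: diff_divide_distrib)
  qed
  show "\<forall>\<^sub>F n in sequentially. real (n div \<alpha>) / real n \<le> 1 / real \<alpha>"
    using eventually_gt_at_top[of 0]
  proof eventually_elim
    case (elim n)
    have "real (n div \<alpha>) / real n \<le> (real n / real \<alpha>) / real n"
      using * by (intro divide_right_mono) auto
    then show ?case using elim by simp
  qed
  have "(\<lambda>n. 1 / real \<alpha> - 1 / real n) \<longlonglongrightarrow> 1 / real \<alpha> - 0"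
    by (intro tendsto_intros lim_1_over_n)
  then show "(\<lambda>n. 1 / real \<alpha> - 1 / real n) \<longlonglongrightarrow> 1 / real \<alpha>" by simp
qed simp

lemma trace_resolvent_tendsto:
  assumes R: "\<And>n. resolvent_mat n t (A n) (R n)"
  shows "(\<lambda>n. mtrace (R n) / of_nat n) \<longlonglongrightarrow>
    of_real (1 / real \<alpha>) * \<gamma> 0 + of_real (1 - 1 / real \<alpha>) * of_real (1 / t)"
proof -
  have "(\<lambda>n. of_real (real (n div \<alpha>) / real n) * \<gamma> 0 + of_real (1 - real (n div \<alpha>) / real n) * of_real (1 / t))
      \<longlonglongrightarrow> of_real (1 / real \<alpha>) * \<gamma> 0 + of_real (1 - 1 / real \<alpha>) * complex_of_real (1 / t)"
    by (intro tendsto_intros div_over_tendsto)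
  moreover have "\<forall>\<^sub>F n in sequentially. of_real (real (n div \<alpha>) / real n) * \<gamma> 0 +
      of_real (1 - real (n div \<alpha>) / real n) * complex_of_real (1 / t) = mtrace (S n) / of_nat n"
    using eventually_gt_at_top[of 0]
  proof eventually_elim
    case (elim n)
    have "complex_of_real (1 - real (n div \<alpha>) / real n) = of_nat (n - n div \<alpha>) / of_nat n"
      using elim by (simp add: of_nat_diff diff_divide_distrib)
    then show ?case unfolding trace_S by (simp add: add_divide_distrib)
  qed
  ultimately have S: "(\<lambda>n. mtrace (S n) / of_nat n) \<longlonglongrightarrow>
      of_real (1 / real \<alpha>) * \<gamma> 0 + of_real (1 - 1 / real \<alpha>) * of_real (1 / t)"
    using Lim_transform_eventually by fast
  have "(\<lambda>n. (mtrace (R n) - mtrace (S n)) / of_nat n) \<longlonglongrightarrow> 0"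
  proof (rule Lim_null_comparison)
    let ?C = "real (3 * L) * (2 + norm1\<^sup>2 / t) / t"
    show "\<forall>\<^sub>F n in sequentially. norm ((mtrace (R n) - mtrace (S n)) / of_nat n) \<le> ?C * (1 / sqrt (real n))"
      using eventually_gt_at_top[of 0]
    proof eventually_elim
      case (elim n)
      have "norm ((mtrace (R n) - mtrace (S n)) / of_nat n) \<le> (?C * sqrt (real n)) / real n"
        unfolding norm_divide norm_of_nat using trace_resolvent_bound[OF R[of n]] by (intro divide_right_mono) auto
      also have "\<dots> = ?C * (1 / sqrt (real n))"
      proof -
        have "sqrt (real n) / real n = 1 / sqrt (real n)" using elim by (simp add: field_simps)
        then show ?thesis by (simp only: times_divide_eq_right[symmetric])
      qed
      finally show ?case .
    qed
    have "(\<lambda>n. 1 / sqrt (real n)) \<longlonglongrightarrow> 0"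
      using tendsto_real_sqrt[OF lim_1_over_n[where ?'a = real]] by (simp add: real_sqrt_divide)
    then show "(\<lambda>n. ?C * (1 / sqrt (real n))) \<longlonglongrightarrow> 0" by (rule tendsto_mult_right_zero)
  qed
  from tendsto_add[OF this S] show ?thesis by (simp add: diff_divide_distrib)
qed

end

section \<open>Density of trigonometric polynomials in \<open>L\<^sup>1\<close>\<close>

text \<open>Stone-Weierstrass yields polynomials in the two real coordinates. On the circle these
  are Laurent polynomials; the form z^(-q) P(z) reduces closure under sums and products to
  polynomial algebra.\<close>

definition laurent_on_circle :: "(complex \<Rightarrow> complex) \<Rightarrow> bool" where
  "laurent_on_circle f \<longleftrightarrow> (\<exists>q P. \<forall>x. f (cis x) = cis (- real q * x) * poly P (cis x))"

lemma laurent_on_circle_add: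
  assumes "laurent_on_circle f" "laurent_on_circle g"
  shows "laurent_on_circle (\<lambda>z. f z + g z)"
proof -
  obtain q P r R where f: "\<And>x. f (cis x) = cis (- real q * x) * poly P (cis x)"
    and g: "\<And>x. g (cis x) = cis (- real r * x) * poly R (cis x)"
    using assms unfolding laurent_on_circle_def by metis
  have shift: "cis (- real k * x) = cis (- real (k + l) * x) * cis x ^ l" for k l x
    by (simp add: Complex.DeMoivre cis_mult algebra_simps)
  have "f (cis x) + g (cis x) = cis (- real (q + r) * x) * poly (monom 1 r * P + monom 1 q * R) (cis x)" for x
    unfolding f g using shift[of q x r] shift[of r x q]
    by (simp add: poly_monom algebra_simps)
  then show ?thesis unfolding laurent_on_circle_def by blast
qed

lemma laurent_on_circle_mult:
  assumes "laurent_on_circle f" "laurent_on_circle g"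
  shows "laurent_on_circle (\<lambda>z. f z * g z)"
proof -
  obtain q P r R where f: "\<And>x. f (cis x) = cis (- real q * x) * poly P (cis x)"
    and g: "\<And>x. g (cis x) = cis (- real r * x) * poly R (cis x)"
    using assms unfolding laurent_on_circle_def by metis
  have "cis (- real (q + r) * x) = cis (- real q * x) * cis (- real r * x)" for x
    by (simp add: cis_mult algebra_simps)
  then have "f (cis x) * g (cis x) = cis (- real (q + r) * x) * poly (P * R) (cis x)" for x
    unfolding f g by (simp add: mult_ac)
  then show ?thesis unfolding laurent_on_circle_def by blast
qed

lemma laurent_on_circle_const: "laurent_on_circle (\<lambda>z. c)"
  unfolding laurent_on_circle_def by (intro exI[of _ 0] exI[of _ "[:c:]"]) simp

lemma laurent_on_circle_bounded_linear:
  fixes f :: "complex \<Rightarrow> real"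
  assumes "bounded_linear f"
  shows "laurent_on_circle (\<lambda>z. of_real (f z))"
proof -
  interpret bounded_linear f by fact
  \<comment> \<open>By real linearity f(z) = f(1) cos x + f(i) sin x = 2 Re (w z) for z = cis x,
    that is, w z + cnj w / z.\<close>
  define w where "w = (of_real (f 1) - \<i> * of_real (f \<i>)) / 2"
  have "complex_of_real (f (cis x)) = cis (- real 1 * x) * poly [:cnj w, 0, w:] (cis x)" for x
  proof -
    have "cis x = cos x *\<^sub>R 1 + sin x *\<^sub>R \<i>" by (simp add: complex_eq_iff)
    then have "f (cis x) = cos x * f 1 + sin x * f \<i>" by (simp only: add scaleR real_scaleR_def)
    then have "complex_of_real (f (cis x)) = cnj w * cis (- x) + w * cis x"
      by (simp add: complex_eq_iff w_def field_simps)
    moreover have "cis (- x) * (cis x * cis x) = cis x" by (simp add: cis_mult)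
    ultimately show ?thesis by (simp add: algebra_simps)
  qed
  then show ?thesis unfolding laurent_on_circle_def by blast
qed

lemma laurent_on_circle_real_polynomial:
  assumes "real_polynomial_function (f :: complex \<Rightarrow> real)"
  shows "laurent_on_circle (\<lambda>z. of_real (f z))"
  using assms
  by induction (simp_all add: laurent_on_circle_bounded_linear laurent_on_circle_const
      laurent_on_circle_add laurent_on_circle_mult)

lemma laurent_on_circle_polynomial_function:
  assumes "polynomial_function (f :: complex \<Rightarrow> complex)"
  shows "laurent_on_circle f"
proof -
  have "real_polynomial_function (Re \<circ> f)" "real_polynomial_function (Im \<circ> f)"
    using assms bounded_linear_Re bounded_linear_Im unfolding polynomial_function_def by auto
  then have "laurent_on_circle (\<lambda>z. of_real ((Re \<circ> f) z) + \<i> * of_real ((Im \<circ> f) z))"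
    by (intro laurent_on_circle_add laurent_on_circle_mult laurent_on_circle_const laurent_on_circle_real_polynomial)
  then show ?thesis by (simp add: complex_eq[symmetric])
qed

lemma laurent_imp_trig_sum:
  assumes "laurent_on_circle f"
  obtains q a where "\<And>x. f (cis x) = trig_sum q a x"
proof -
  obtain q P where f: "\<And>x. f (cis x) = cis (- real q * x) * poly P (cis x)"
    using assms unfolding laurent_on_circle_def by metis
  \<comment> \<open>The frequencies run from -q to degree P - q; this r makes the symmetric window
    contain them.\<close>
  define r where "r = q + degree P"
  define a where "a k = (if k + int q \<ge> 0 then coeff P (nat (k + int q)) else 0)" for k
  have "f (cis x) = trig_sum r a x" for x
  proof -
    have "f (cis x) = (\<Sum>i\<le>degree P. coeff P i * cis (real_of_int (int i - int q) * x))"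
      unfolding f poly_altdef sum_distrib_left
      by (intro sum.cong refl) (simp add: Complex.DeMoivre cis_mult mult.left_commute algebra_simps)
    also have "\<dots> = (\<Sum>k\<in>(\<lambda>i. int i - int q) ` {..degree P}. a k * cis (real_of_int k * x))"
      by (subst sum.reindex) (auto simp: inj_on_def a_def)
    also have "\<dots> = trig_sum r a x"
      unfolding trig_sum_def
    proof (rule sum.mono_neutral_left)
      show "\<forall>k\<in>{- int r..int r} - (\<lambda>i. int i - int q) ` {..degree P}. a k * cis (real_of_int k * x) = 0"
      proof
        fix k assume k: "k \<in> {- int r..int r} - (\<lambda>i. int i - int q) ` {..degree P}"
        have "a k = 0"
        proof (cases "k + int q \<ge> 0")
          case True
          then have "k = int (nat (k + int q)) - int q" by simp
          with k have "degree P < nat (k + int q)" by (metis DiffD2 atMost_iff imageI not_less)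
          then show ?thesis by (simp add: a_def coeff_eq_0)
        qed (simp add: a_def)
        then show "a k * cis (real_of_int k * x) = 0" by simp
      qed
    qed (auto simp: r_def)
    finally show ?thesis .
  qed
  then show thesis by (rule that)
qed

text \<open>The values of a continuous function at -pi and pi need not agree, so it need not descend
  to the circle. For n \<ge> 1 the cutoff vanishes where 1 + Re z \<le> 1 / n, near the point -1,
  and equals 1 where 1 + Re z \<ge> 2 / n.\<close>

definition cutoff :: "nat \<Rightarrow> complex \<Rightarrow> real" where
  "cutoff n z = max 0 (min 1 (real n * (1 + Re z) - 1))"

lemma cutoff_bounds: "0 \<le> cutoff n z" "cutoff n z \<le> 1"
  by (auto simp: cutoff_def)

lemma continuous_on_cutoff [continuous_intros]:
  "continuous_on A f \<Longrightarrow> continuous_on A (\<lambda>x. cutoff n (f x))"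
  unfolding cutoff_def by (intro continuous_intros)

lemma cutoff_tendsto:
  assumes "Re z > -1"
  shows "(\<lambda>n. cutoff n z) \<longlonglongrightarrow> 1"
proof (rule tendsto_eventually)
  obtain N :: nat where N: "real N > 2 / (1 + Re z)" using reals_Archimedean2 by blast
  show "\<forall>\<^sub>F n in sequentially. cutoff n z = 1"
    using eventually_ge_at_top[of N]
  proof eventually_elim
    case (elim n)
    then have "2 / (1 + Re z) < real n" using N by linarith
    then have "2 < real n * (1 + Re z)" using assms by (simp add: field_simps)
    then show ?case by (simp add: cutoff_def)
  qed
qed

text \<open>On the circle \<open>Arg\<close> jumps only at -1. Two relatively open pieces suffice:
  the complement of that point, and a set on which the cutoff makes the product zero.\<close>

lemma continuous_on_circle_cutoff_Arg:
  fixes g :: "real \<Rightarrow> complex"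
  assumes "continuous_on UNIV g"
  shows "continuous_on (sphere 0 1) (\<lambda>z. cutoff n z *\<^sub>R g (Arg z))"
proof -
  let ?S = "sphere 0 1 \<inter> {z. Re z > -1} :: complex set" and ?T = "sphere 0 1 \<inter> {z. real n * (1 + Re z) < 1} :: complex set"
  have cover: "?S \<union> ?T = sphere 0 1"
  proof (intro equalityI subsetI)
    fix z :: complex assume z: "z \<in> sphere 0 1"
    then have "\<bar>Re z\<bar> \<le> 1" using abs_Re_le_cmod[of z] by simp
    then have "Re z > -1 \<or> Re z = -1" by linarith
    then show "z \<in> ?S \<union> ?T" using z by auto
  qed auto
  have o: "open {z. Re z > -1}" "open {z. real n * (1 + Re z) < 1}"
    by (intro open_Collect_less continuous_intros)+
  have "continuous_on (?S \<union> ?T) (\<lambda>z. cutoff n z *\<^sub>R g (Arg z))"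
  proof (rule continuous_on_Un_local_open)
    show "openin (top_of_set (?S \<union> ?T)) ?S" "openin (top_of_set (?S \<union> ?T)) ?T"
      unfolding cover using o by (auto simp: openin_open)
    have "z \<notin> \<real>\<^sub>\<le>\<^sub>0" if "z \<in> ?S" for z
    proof
      assume "z \<in> \<real>\<^sub>\<le>\<^sub>0"
      then have "Re z \<le> 0" "Im z = 0" by (auto simp: complex_nonpos_Reals_iff)
      then have "cmod z = - Re z" by (simp add: cmod_eq_Re)
      then show False using that by auto
    qed
    then have "continuous_on ?S Arg"
      by (meson continuous_at_Arg continuous_at_imp_continuous_on)
    then have "continuous_on ?S (\<lambda>z. g (Arg z))"
      using continuous_on_compose2[OF assms] by blast
    then show "continuous_on ?S (\<lambda>z. cutoff n z *\<^sub>R g (Arg z))"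
      by (intro continuous_intros)
    have "cutoff n z *\<^sub>R g (Arg z) = 0" if "z \<in> ?T" for z
      using that by (simp add: cutoff_def)
    then show "continuous_on ?T (\<lambda>z. cutoff n z *\<^sub>R g (Arg z))"
      by (subst continuous_on_cong[OF refl, of _ _ "\<lambda>_. 0"]) auto
  qed
  then show ?thesis unfolding cover .
qed

lemma trig_sum_uniform_approx:
  fixes g :: "real \<Rightarrow> complex"
  assumes "continuous_on UNIV g" "e > 0"
  obtains q a where "\<And>x. x \<in> {-pi<..<pi} \<Longrightarrow> cmod (cutoff n (cis x) *\<^sub>R g x - trig_sum q a x) < e"
proof -
  obtain P where P: "polynomial_function P"
    "\<And>z. z \<in> sphere 0 1 \<Longrightarrow> cmod (cutoff n z *\<^sub>R g (Arg z) - P z) < e"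
    using Stone_Weierstrass_polynomial_function[OF compact_sphere continuous_on_circle_cutoff_Arg[OF assms(1), of n] assms(2)]
    by blast
  obtain q a where "\<And>x. P (cis x) = trig_sum q a x"
    using laurent_imp_trig_sum[OF laurent_on_circle_polynomial_function[OF P(1)]] by blast
  moreover have "Arg (cis x) = x" if "x \<in> {-pi<..<pi}" for x
    using that by (simp add: Arg_cis)
  ultimately show thesis using P(2)[of "cis x" for x] that by (metis mem_sphere_0 norm_cis)
qed

text \<open>Truncation as the metric projection onto a ball: convexity makes it continuous and
  non-expansive, and its bound supplies a dominating constant.\<close>

abbreviation truncate :: "nat \<Rightarrow> complex \<Rightarrow> complex" where
  "truncate N \<equiv> closest_point (cball 0 (real N))"

lemma truncate_props:
  shows "cmod (truncate N z) \<le> real N" "cmod (truncate N z) \<le> cmod z"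
    "cmod z \<le> real N \<Longrightarrow> truncate N z = z" "continuous_on A (truncate N)"
proof -
  have *: "convex (cball (0 :: complex) (real N))" "closed (cball (0 :: complex) (real N))" "cball (0 :: complex) (real N) \<noteq> {}"
    by auto
  show "cmod (truncate N z) \<le> real N" using closest_point_in_set[OF *(2,3), of z] by simp
  have "dist (truncate N z) (truncate N 0) \<le> dist z 0" by (rule closest_point_lipschitz[OF *])
  moreover have "truncate N 0 = 0" by (rule closest_point_self) simp
  ultimately show "cmod (truncate N z) \<le> cmod z" by (simp add: dist_norm)
  show "cmod z \<le> real N \<Longrightarrow> truncate N z = z" by (rule closest_point_self) simp
  show "continuous_on A (truncate N)" by (rule continuous_on_closest_point[OF *])
qed

text \<open>Measurability gives continuous functions converging almost everywhere, but without a
  common bound. Truncating both f and these functions at one level N makes dominated convergence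
  available; the three errors are f to its truncation, truncation to a cut-off continuous function,
  and that to a polynomial.\<close>

lemma trig_sum_L1_dense:
  assumes f: "integrable Qm f" and e: "e > 0"
  obtains q a where "(\<integral>x. cmod (f x - trig_sum q a x) \<partial>Qm) < e"
proof -
  have fm [measurable]: "f \<in> borel_measurable Qm" using f by auto
  have tm [measurable]: "truncate N \<in> borel_measurable borel" for N
    by (rule borel_measurable_continuous_onI[OF truncate_props(4)])
  have "(\<lambda>N. (\<integral>x. cmod (f x - truncate N (f x)) \<partial>Qm)) \<longlonglongrightarrow> (\<integral>x. 0 \<partial>Qm)"
  proof (rule integral_dominated_convergence[where w = "\<lambda>x. 2 * cmod (f x)"])
    show "AE x in Qm. (\<lambda>N. cmod (f x - truncate N (f x))) \<longlonglongrightarrow> 0"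
    proof (rule AE_I2)
      fix x
      obtain N where N: "cmod (f x) \<le> real N" using real_arch_simple by blast
      have "cmod (f x - truncate n (f x)) = 0" if "n \<ge> N" for n
        using N that by (simp add: truncate_props(3))
      then show "(\<lambda>N. cmod (f x - truncate N (f x))) \<longlonglongrightarrow> 0"
        by (intro tendsto_eventually eventually_sequentiallyI[of N]) auto
    qed
    show "AE x in Qm. norm (cmod (f x - truncate N (f x))) \<le> 2 * cmod (f x)" for N
    proof (rule AE_I2)
      fix x
      show "norm (cmod (f x - truncate N (f x))) \<le> 2 * cmod (f x)"
        using norm_triangle_ineq4[of "f x" "truncate N (f x)"] truncate_props(2)[of N "f x"] by simp
    qed
  qed (use f in auto)
  then have "\<forall>\<^sub>F N in sequentially. (\<integral>x. cmod (f x - truncate N (f x)) \<partial>Qm) < e / 3"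
    using e by (intro order_tendstoD(2)[of _ 0]) auto
  then obtain N where N: "(\<integral>x. cmod (f x - truncate N (f x)) \<partial>Qm) < e / 3"
    using eventually_happens'[OF sequentially_bot] by blast
  define u where "u = (\<lambda>x. truncate N (f x))"
  have um [measurable]: "u \<in> borel_measurable Qm" unfolding u_def by measurable
  have ui: "integrable Qm u"
    by (rule integrable_Qm_bounded[of _ "real N"]) (auto simp: u_def truncate_props)
  \<comment> \<open>Unfolding \<open>measurable_on\<close> provides the continuous functions and the
    negligible exceptional set.\<close>
  have "f measurable_on {-pi<..<pi}"
    using fm by (subst measurable_on_iff_borel_measurable) auto
  then obtain Z g where Z: "negligible Z" and gc: "\<And>n. continuous_on UNIV (g n)"
    and g: "\<And>x. x \<notin> Z \<Longrightarrow> (\<lambda>n. g n x) \<longlonglongrightarrow> (if x \<in> {-pi<..<pi} then f x else 0)"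
    unfolding measurable_on_def by blast
  have AEZ: "AE x in Qm. x \<notin> Z"
  proof -
    have "AE x in lebesgue. x \<notin> Z" 
      using Z by (simp add: negligible_iff_null_sets AE_not_in)
    then show ?thesis by (subst AE_restrict_space_iff) auto
  qed
  define G where "G n x = truncate N (g n x)" for n x
  have Gc: "continuous_on UNIV (G n)" for n
    unfolding G_def by (rule continuous_on_compose2[OF truncate_props(4) gc]) auto
  define w where "w n x = cutoff n (cis x) *\<^sub>R G n x" for n x
  have wc: "continuous_on UNIV (w n)" for n
    unfolding w_def by (intro continuous_intros Gc)
  have wm [measurable]: "w n \<in> borel_measurable Qm" for n
    by (rule continuous_measurable_Qm[OF wc])
  have wb: "cmod (w n x) \<le> real N" for n x
  proof -
    have "cmod (w n x) = cutoff n (cis x) * cmod (G n x)" by (simp add: w_def cutoff_bounds)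
    also have "\<dots> \<le> 1 * real N" by (intro mult_mono) (auto simp: cutoff_bounds G_def truncate_props)
    finally show ?thesis by simp
  qed
  have wi: "integrable Qm (w n)" for n by (rule integrable_Qm_bounded[OF wm wb])
  have "(\<lambda>n. (\<integral>x. cmod (u x - w n x) \<partial>Qm)) \<longlonglongrightarrow> (\<integral>x. 0 \<partial>Qm)"
  proof (rule integral_dominated_convergence[where w = "\<lambda>x. 2 * real N"])
    show "AE x in Qm. (\<lambda>n. cmod (u x - w n x)) \<longlonglongrightarrow> 0"
      using AEZ AE_space
    proof eventually_elim
      case (elim x)
      then have x: "x \<in> {-pi<..<pi}" by (simp add: space_restrict_space)
      then have "(\<lambda>n. g n x) \<longlonglongrightarrow> f x" using g[of x] elim by simp
      moreover have "isCont (truncate N) (f x)"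
        using truncate_props(4)[of UNIV N] by (simp add: continuous_on_eq_continuous_at)
      ultimately have "(\<lambda>n. G n x) \<longlonglongrightarrow> u x"
        unfolding G_def u_def by (rule isCont_tendsto_compose[rotated])
      moreover have "Re (cis x) > -1"
      proof -
        have "\<bar>x\<bar> < pi" using x by auto
        then have "cos \<bar>x\<bar> > cos pi" by (intro cos_monotone_0_pi) auto
        then show ?thesis by simp
      qed
      ultimately have "(\<lambda>n. w n x) \<longlonglongrightarrow> 1 *\<^sub>R u x"
        unfolding w_def by (intro tendsto_scaleR cutoff_tendsto)
      then have "(\<lambda>n. u x - w n x) \<longlonglongrightarrow> u x - 1 *\<^sub>R u x" by (intro tendsto_diff tendsto_const)
      then show ?case by (intro tendsto_norm_zero) simp
    qed
    show "AE x in Qm. norm (cmod (u x - w n x)) \<le> 2 * real N" for n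
    proof (rule AE_I2)
      fix x
      show "norm (cmod (u x - w n x)) \<le> 2 * real N"
        using norm_triangle_ineq4[of "u x" "w n x"] truncate_props(1)[of N "f x"] wb[of n x] unfolding u_def by simp
    qed
    show "integrable Qm (\<lambda>x. 2 * real N)"
      by (rule finite_measure.integrable_const[OF finite_measure_Qm])
  qed auto
  then have "\<forall>\<^sub>F n in sequentially. (\<integral>x. cmod (u x - w n x) \<partial>Qm) < e / 3"
    using e by (intro order_tendstoD(2)[of _ 0]) auto
  then obtain n where n: "(\<integral>x. cmod (u x - w n x) \<partial>Qm) < e / 3"
    using eventually_happens'[OF sequentially_bot] by blast
  \<comment> \<open>The interval has length 2 pi < 8, so a uniform error e / 24 integrates to less
    than e / 3.\<close>
  then obtain q a where qa: "\<And>x. x \<in> {-pi<..<pi} \<Longrightarrow> cmod (w n x - trig_sum q a x) < e / 24"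
    using trig_sum_uniform_approx[OF Gc[of n], of "e / 24" n] e unfolding w_def by auto
  have "(\<integral>x. cmod (w n x - trig_sum q a x) \<partial>Qm) \<le> (\<integral>x. e / 24 \<partial>Qm)"
    by (intro integral_mono integrable_norm Bochner_Integration.integrable_diff wi integrable_trig_sum 
        finite_measure.integrable_const[OF finite_measure_Qm])
      (use qa in \<open>auto intro: less_imp_le\<close>)
  also have "\<dots> = e / 24 * (2 * pi)" using measure_Qm by simp
  also have "\<dots> < e / 24 * 8" using e pi_less_4 by (intro mult_strict_left_mono) auto
  finally have 3: "(\<integral>x. cmod (w n x - trig_sum q a x) \<partial>Qm) < e / 3" by simp
  have "(\<integral>x. cmod (f x - trig_sum q a x) \<partial>Qm) \<le>
      (\<integral>x. cmod (f x - u x) + cmod (u x - w n x) + cmod (w n x - trig_sum q a x) \<partial>Qm)"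
  proof (rule integral_mono)
    fix x
    show "cmod (f x - trig_sum q a x) \<le> cmod (f x - u x) + cmod (u x - w n x) + cmod (w n x - trig_sum q a x)"
      using norm_triangle_ineq[of "f x - u x" "u x - trig_sum q a x"]
        norm_triangle_ineq[of "u x - w n x" "w n x - trig_sum q a x"] by simp
  qed (use f ui wi integrable_trig_sum in auto)
  also have "\<dots> = (\<integral>x. cmod (f x - u x) \<partial>Qm) + (\<integral>x. cmod (u x - w n x) \<partial>Qm) + (\<integral>x. cmod (w n x - trig_sum q a x) \<partial>Qm)"
    using f ui wi integrable_trig_sum by simp
  also have "\<dots> < e" using N n 3 unfolding u_def by linarith
  finally show thesis by (rule that)
qed

text \<open>Both modes of convergence are used for the same sequence: L^1 convergence controls the
  matrices, almost everywhere convergence controls the symbols. The second costs a passage to a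
  subsequence.\<close>

lemma trig_sum_approx_sequence:
  assumes f: "integrable Qm f"
  obtains q a where "(\<lambda>k. \<integral>x. cmod (f x - trig_sum (q k) (a k) x) \<partial>Qm) \<longlonglongrightarrow> 0"
    "AE x in Qm. (\<lambda>k. trig_sum (q k) (a k) x) \<longlonglongrightarrow> f x"
proof -
  have "\<exists>q a. (\<integral>x. cmod (f x - trig_sum q a x) \<partial>Qm) < 1 / real (Suc k)" for k
    using trig_sum_L1_dense[OF f, of "1 / real (Suc k)"] by (metis of_nat_0_less_iff zero_less_Suc zero_less_divide_1_iff)
  then obtain q a where qa: "\<And>k. (\<integral>x. cmod (f x - trig_sum (q k) (a k) x) \<partial>Qm) < 1 / real (Suc k)"
    by metis
  have lim: "(\<lambda>k. \<integral>x. cmod (f x - trig_sum (q k) (a k) x) \<partial>Qm) \<longlonglongrightarrow> 0"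
    using qa by (intro tendsto_sandwich[OF _ _ tendsto_const LIMSEQ_Suc[OF lim_1_over_n]])
      (auto intro!: always_eventually less_imp_le[OF qa] simp del: of_nat_Suc)
  obtain r where r: "strict_mono r" "AE x in Qm. (\<lambda>k. f x - trig_sum (q (r k)) (a (r k)) x) \<longlonglongrightarrow> 0"
    using tendsto_L1_AE_subseq[OF Bochner_Integration.integrable_diff[OF f integrable_trig_sum] lim] by auto
  show thesis
  proof (rule that[of "q \<circ> r" "a \<circ> r"])
    show "(\<lambda>k. \<integral>x. cmod (f x - trig_sum ((q \<circ> r) k) ((a \<circ> r) k) x) \<partial>Qm) \<longlonglongrightarrow> 0"
      using LIMSEQ_subseq_LIMSEQ[OF lim r(1)] by (simp add: o_def)
    show "AE x in Qm. (\<lambda>k. trig_sum ((q \<circ> r) k) ((a \<circ> r) k) x) \<longlonglongrightarrow> f x"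
      using r(2)
    proof eventually_elim
      case (elim x)
      from tendsto_diff[OF tendsto_const[of "f x"] elim] show ?case by simp
    qed
  qed
qed

section \<open>From resolvents to arbitrary test functions\<close>

text \<open>Interchange of limits, used once for approximating the test function and once for
  approximating f.\<close>

lemma LIMSEQ_uniform_approx:
  fixes x :: "nat \<Rightarrow> 'a::metric_space"
  assumes "\<And>e. e > 0 \<Longrightarrow> \<exists>y m. y \<longlonglongrightarrow> m \<and> (\<forall>n. dist (x n) (y n) \<le> e) \<and> dist l m \<le> e"
  shows "x \<longlonglongrightarrow> l"
proof (rule tendstoI)
  fix e :: real assume e: "e > 0"
  then obtain y m where y: "y \<longlonglongrightarrow> m" "\<And>n. dist (x n) (y n) \<le> e / 4" "dist l m \<le> e / 4"
    using assms[of "e / 4"] by auto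
  have "\<forall>\<^sub>F n in sequentially. dist (y n) m < e / 4"
    using y(1) e by (intro tendstoD) auto
  then show "\<forall>\<^sub>F n in sequentially. dist (x n) l < e"
  proof eventually_elim
    case (elim n)
    have "dist (x n) l \<le> dist (x n) (y n) + dist (y n) m + dist l m"
      by (metis dist_commute dist_triangle dist_triangle2 add_mono order_refl order_trans dist_triangle_le add.commute add_left_mono)
    then show ?case using y(2)[of n] y(3) elim e by linarith
  qed
qed

text \<open>The closed linear span is an inductive predicate, so convergence can be proved by
  induction over its rules. Closeness is asked only for s \<ge> 0, where singular values and moduli
  lie.\<close>

inductive resolvent_approx :: "(real \<Rightarrow> complex) \<Rightarrow> bool" where
  basic: "t > 0 \<Longrightarrow> resolvent_approx (\<lambda>s. of_real (1 / (s\<^sup>2 + t)))"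
| add: "resolvent_approx F \<Longrightarrow> resolvent_approx G \<Longrightarrow> resolvent_approx (\<lambda>s. F s + G s)"
| scale: "resolvent_approx F \<Longrightarrow> resolvent_approx (\<lambda>s. c * F s)"
| limit: "(\<And>e. e > 0 \<Longrightarrow> \<exists>G. resolvent_approx G \<and> (\<forall>s\<ge>0. cmod (F s - G s) \<le> e)) \<Longrightarrow> resolvent_approx F"

lemma resolvent_approx_zero: "resolvent_approx (\<lambda>s. 0)"
  using resolvent_approx.scale[OF resolvent_approx.basic[of 1], of 0] by simp

lemma resolvent_approx_sum:
  "finite I \<Longrightarrow> (\<And>i. i \<in> I \<Longrightarrow> resolvent_approx (F i)) \<Longrightarrow> resolvent_approx (\<lambda>s. \<Sum>i\<in>I. F i s)"
  by (induction I rule: finite_induct) (auto intro: resolvent_approx.add resolvent_approx_zero)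

lemma resolvent_approx_diff:
  "resolvent_approx F \<Longrightarrow> resolvent_approx G \<Longrightarrow> resolvent_approx (\<lambda>s. F s - G s)"
  using resolvent_approx.add[OF _ resolvent_approx.scale[of G "-1"], of F] by simp

lemma resolvent_approx_continuous_bounded:
  assumes "resolvent_approx F"
  shows "continuous_on {0..} F \<and> (\<exists>B. \<forall>s\<ge>0. cmod (F s) \<le> B)"
  using assms
proof induction
  case (basic t)
  have "s\<^sup>2 + t \<noteq> 0" for s using basic by (metis add_nonneg_pos less_irrefl zero_le_power2)
  then have "continuous_on {0..} (\<lambda>s. complex_of_real (1 / (s\<^sup>2 + t)))"
    by (intro continuous_intros) auto
  moreover have "cmod (of_real (1 / (s\<^sup>2 + t))) \<le> 1 / t" for s
    using basic unfolding norm_of_real by (simp add: frac_le add_pos_nonneg)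
  ultimately show ?case by blast
next
  case (add F G)
  then obtain B C where "\<forall>s\<ge>0. cmod (F s) \<le> B" "\<forall>s\<ge>0. cmod (G s) \<le> C" by blast
  then have "\<forall>s\<ge>0. cmod (F s + G s) \<le> B + C"
    by (meson add_mono norm_triangle_le)
  then show ?case using add by (auto intro: continuous_on_add)
next
  case (scale F c)
  then obtain B where "\<forall>s\<ge>0. cmod (F s) \<le> B" by blast
  then have "\<forall>s\<ge>0. cmod (c * F s) \<le> cmod c * B"
    by (simp add: norm_mult mult_left_mono)
  then show ?case using scale by (auto intro: continuous_on_mult_left)
next
  case (limit F)
  have "\<exists>G. (continuous_on {0..} G \<and> (\<exists>B. \<forall>s\<ge>0. cmod (G s) \<le> B)) \<and> (\<forall>s\<ge>0. cmod (F s - G s) \<le> 1 / real (Suc n))" for n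
    using limit.IH[of "1 / real (Suc n)"] by auto
  then obtain G where G: "\<And>n. continuous_on {0..} (G n)" "\<And>n. \<exists>B. \<forall>s\<ge>0. cmod (G n s) \<le> B"
    "\<And>n s. s \<ge> 0 \<Longrightarrow> cmod (F s - G n s) \<le> 1 / real (Suc n)" by metis
  have "uniform_limit {0..} G F sequentially"
  proof (rule uniform_limitI)
    fix e :: real assume "e > 0"
    then have "\<forall>\<^sub>F n in sequentially. 1 / real (Suc n) < e"
      using LIMSEQ_Suc[OF lim_1_over_n] by (intro order_tendstoD(2)[of _ 0]) auto
    then show "\<forall>\<^sub>F n in sequentially. \<forall>s\<in>{0..}. dist (G n s) (F s) < e"
    proof eventually_elim
      case (elim n)
      then show ?case using G(3)[of _ n] by (auto simp: dist_norm norm_minus_commute intro: le_less_trans simp del: of_nat_Suc)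
    qed
  qed
  then have "continuous_on {0..} F"
    by (intro uniform_limit_theorem) (auto simp: G)
  moreover obtain B where B: "\<forall>s\<ge>0. cmod (G 0 s) \<le> B" using G(2) by blast
  have "cmod (F s) \<le> B + 1" if "s \<ge> 0" for s
    using B that G(3)[of s 0] norm_triangle_ineq[of "G 0 s" "F s - G 0 s"] by force
  ultimately show ?case by blast
qed

text \<open>Partial fractions write a product with two distinct shifts as a combination of the
  factors; a repeated shift is the uniform limit of distinct ones. Thus powers of 1 / (s^2 + 1) lie
  in the closed span.\<close>

lemma resolvent_approx_mult_basic:
  assumes "resolvent_approx F" "t > 0"
  shows "resolvent_approx (\<lambda>s. F s * of_real (1 / (s\<^sup>2 + t)))"
  using assms(1)
proof induction
  case (basic r)
  have pos: "s\<^sup>2 + r > 0" "s\<^sup>2 + t > 0" for s using basic assms(2) by (simp_all add: add_nonneg_pos)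
  have distinct: "resolvent_approx (\<lambda>s. of_real (1 / (s\<^sup>2 + r)) * of_real (1 / (s\<^sup>2 + t')))"
    if t': "t' > 0" "t' \<noteq> r" for t'
  proof -
    have "of_real (1 / (s\<^sup>2 + r)) * complex_of_real (1 / (s\<^sup>2 + t')) =
        of_real (1 / (t' - r)) * (of_real (1 / (s\<^sup>2 + r)) - of_real (1 / (s\<^sup>2 + t')))" for s
    proof -
      have "s\<^sup>2 + t' > 0" using t' by (simp add: add_nonneg_pos)
      then have "1 / (s\<^sup>2 + r) * (1 / (s\<^sup>2 + t')) = 1 / (t' - r) * (1 / (s\<^sup>2 + r) - 1 / (s\<^sup>2 + t'))"
        using pos(1)[of s] t' by (simp add: divide_simps) 
      then show ?thesis by (simp only: of_real_mult[symmetric] of_real_diff[symmetric])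
    qed
    then show ?thesis
      by (simp only:) (intro resolvent_approx.scale resolvent_approx_diff resolvent_approx.basic basic t')
  qed
  show ?case
  proof (cases "t = r")
    case False
    then show ?thesis using distinct assms(2) by simp
  next
    case True
    show ?thesis
    proof (rule resolvent_approx.limit)
      fix e :: real assume e: "e > 0"
      \<comment> \<open>The error of replacing one shift t by t + d is d / (u * u * (u + d)) with u
        \<ge> t, hence at most d / t^3 = e.\<close>
      define d where "d = e * t ^ 3"
      have d: "d > 0" using e assms(2) by (simp add: d_def)
      show "\<exists>G. resolvent_approx G \<and> (\<forall>s\<ge>0. cmod (of_real (1 / (s\<^sup>2 + r)) * of_real (1 / (s\<^sup>2 + t)) - G s) \<le> e)"
      proof (intro exI conjI allI impI)
        show "resolvent_approx (\<lambda>s. of_real (1 / (s\<^sup>2 + r)) * of_real (1 / (s\<^sup>2 + (t + d))))"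
          using distinct[of "t + d"] d assms(2) True by simp
        fix s :: real
        let ?u = "s\<^sup>2 + t"
        have u: "?u \<ge> t" "?u > 0" using assms(2) by (simp_all add: add_nonneg_pos)
        have "1 / ?u * (1 / ?u) - 1 / ?u * (1 / (?u + d)) = d / (?u * ?u * (?u + d))"
          using u d by (simp add: divide_simps)
        moreover have "0 \<le> d / (?u * ?u * (?u + d))" using u d by simp
        moreover have "t * t * t \<le> ?u * ?u * (?u + d)"
          using u d assms(2) by (intro mult_mono) auto
        then have "d / (?u * ?u * (?u + d)) \<le> d / (t * t * t)"
          using assms(2) d by (intro divide_left_mono) (auto intro!: mult_pos_pos u add_pos_pos)
        moreover have "d / (t * t * t) = e" using assms(2) by (simp add: d_def power3_eq_cube)
        ultimately have "\<bar>1 / ?u * (1 / ?u) - 1 / ?u * (1 / (?u + d))\<bar> \<le> e" by linarith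
        then have "cmod (of_real (1 / ?u * (1 / ?u) - 1 / ?u * (1 / (?u + d)))) \<le> e"
          by (simp only: norm_of_real)
        then show "cmod (of_real (1 / (s\<^sup>2 + r)) * of_real (1 / (s\<^sup>2 + t)) - of_real (1 / (s\<^sup>2 + r)) * of_real (1 / (s\<^sup>2 + (t + d)))) \<le> e"
          by (simp only: of_real_diff of_real_mult True add.assoc)
      qed
    qed
  qed
next
  case (add F G)
  then show ?case by (simp add: distrib_right resolvent_approx.add del: of_real_divide)
next
  case (scale F c)
  then show ?case using resolvent_approx.scale[of _ c] by (simp add: mult.assoc del: of_real_divide)
next
  case (limit F)
  show ?case
  proof (rule resolvent_approx.limit)
    fix e :: real assume e: "e > 0"
    \<comment> \<open>The factor has modulus at most 1 / t and turns accuracy e * t into e.\<close>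
    then have "e * t > 0" using assms(2) by simp
    from limit.IH[OF this] obtain G where
      G: "resolvent_approx (\<lambda>s. G s * of_real (1 / (s\<^sup>2 + t)))" "\<And>s. s \<ge> 0 \<Longrightarrow> cmod (F s - G s) \<le> e * t"
      by blast
    have "cmod (F s * of_real (1 / (s\<^sup>2 + t)) - G s * of_real (1 / (s\<^sup>2 + t))) \<le> e" if "s \<ge> 0" for s
    proof -
      have "cmod (of_real (1 / (s\<^sup>2 + t))) \<le> 1 / t"
        using assms(2) unfolding norm_of_real by (simp add: frac_le add_pos_nonneg)
      then have "cmod (F s - G s) * cmod (of_real (1 / (s\<^sup>2 + t))) \<le> (e * t) * (1 / t)"
        using G(2)[OF that] e assms(2) by (intro mult_mono) auto
      then show ?thesis using assms(2) by (simp add: norm_mult left_diff_distrib[symmetric] del: of_real_divide)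
    qed
    then show "\<exists>G. resolvent_approx G \<and> (\<forall>s\<ge>0. cmod (F s * of_real (1 / (s\<^sup>2 + t)) - G s) \<le> e)"
      using G(1) by blast
  qed
qed

lemma resolvent_approx_power: "resolvent_approx (\<lambda>s. of_real (1 / (s\<^sup>2 + 1)) ^ Suc k)"
proof (induction k)
  case 0
  show ?case using resolvent_approx.basic[of 1] by simp
next
  case (Suc k)
  from resolvent_approx_mult_basic[OF this, of 1] show ?case by (simp add: mult_ac del: of_real_divide)
qed

text \<open>The constant term is subtracted because every function in the closed span decays at
  infinity.\<close>

lemma resolvent_approx_polynomial:
  assumes "real_polynomial_function (p :: real \<Rightarrow> real)"
  shows "resolvent_approx (\<lambda>s. of_real (p (1 / (s\<^sup>2 + 1)) - p 0))"
proof -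
  obtain a n where p: "p = (\<lambda>x. \<Sum>i\<le>n. a i * x ^ i)"
    using assms real_polynomial_function_iff_sum by blast
  have "p x - p 0 = (\<Sum>i<n. a (Suc i) * x ^ Suc i)" for x
    unfolding p by (simp add: sum.atMost_shift)
  then have "(\<lambda>s. complex_of_real (p (1 / (s\<^sup>2 + 1)) - p 0)) =
      (\<lambda>s. \<Sum>i<n. of_real (a (Suc i)) * of_real (1 / (s\<^sup>2 + 1)) ^ Suc i)"
    by (simp only: of_real_sum of_real_mult of_real_power)
  then show ?thesis
    by (simp only:) (intro resolvent_approx_sum resolvent_approx.scale resolvent_approx_power, simp)
qed

text \<open>In the variable \<open>y = 1 / (s\<^sup>2 + 1)\<close> a test function becomes a continuous function on
  \<open>[0, 1]\<close> that vanishes near \<open>0\<close>.\<close>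

lemma C0_resolvent_approx:
  assumes F: "F \<in> C0_nonneg"
  shows "resolvent_approx F"
proof -
  have Fc: "continuous_on {0..} F" using F by (simp add: C0_nonneg_def)
  obtain B where "\<And>s. s \<ge> 0 \<Longrightarrow> F s \<noteq> 0 \<Longrightarrow> \<bar>s\<bar> \<le> B"
    using F by (auto simp: C0_nonneg_def bounded_iff)
  then have F0: "F s = 0" if "s > B" "s \<ge> 0" for s using that by fastforce
  define \<phi> where "\<phi> y = (if y \<le> 0 then 0 else F (sqrt (1 / y - 1)))" for y :: real
  \<comment> \<open>For 0 < y < d the point sqrt (1 / y - 1) exceeds |B| and lies beyond the support
    of F.\<close>
  define d where "d = 1 / (\<bar>B\<bar>\<^sup>2 + 1)"
  have d: "d > 0" by (simp add: d_def add_nonneg_pos)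
  have \<phi>0: "\<phi> y = 0" if "y < d" "y \<le> 1" for y
  proof (cases "y \<le> 0")
    case False
    have "y * (\<bar>B\<bar>\<^sup>2 + 1) < 1"
      using that(1) unfolding d_def by (subst (asm) pos_less_divide_eq) (simp_all add: add_nonneg_pos)
    then have "1 / y - 1 > \<bar>B\<bar>\<^sup>2" using False by (simp add: field_simps)
    then have "sqrt (1 / y - 1) > \<bar>B\<bar>" using real_less_rsqrt by blast
    then have "sqrt (1 / y - 1) > B" by linarith
    then show ?thesis using F0[of "sqrt (1 / y - 1)"] False that by (simp add: \<phi>_def)
  qed (simp add: \<phi>_def)
  let ?S = "{0..1} \<inter> {0<..} :: real set" and ?T = "{0..1} \<inter> {..<d} :: real set"
  have cover: "?S \<union> ?T = {0..1}" using d by auto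
  have "continuous_on (?S \<union> ?T) \<phi>"
  proof (rule continuous_on_Un_local_open)
    show "openin (top_of_set (?S \<union> ?T)) ?S" "openin (top_of_set (?S \<union> ?T)) ?T"
      unfolding cover by (rule openin_open_Int; simp)+
    have "continuous_on ?S (\<lambda>y :: real. sqrt (1 / y - 1))"
      by (intro continuous_on_real_sqrt continuous_on_diff continuous_on_divide continuous_on_const continuous_on_id) auto
    moreover have "(\<lambda>y :: real. sqrt (1 / y - 1)) ` ?S \<subseteq> {0..}"
      by (auto simp: field_simps)
    ultimately have "continuous_on ?S (\<lambda>y. F (sqrt (1 / y - 1)))"
      by (rule continuous_on_compose2[OF Fc])
    then show "continuous_on ?S \<phi>"
      by (subst continuous_on_cong[OF refl, of _ _ "\<lambda>y. F (sqrt (1 / y - 1))"]) (auto simp: \<phi>_def)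
    show "continuous_on ?T \<phi>"
      by (subst continuous_on_cong[OF refl, of _ _ "\<lambda>_. 0"]) (auto simp: \<phi>0)
  qed
  then have \<phi>c: "continuous_on {0..1} \<phi>" unfolding cover .
  show ?thesis
  proof (rule resolvent_approx.limit)
    fix e :: real assume "e > 0"
    \<comment> \<open>One half of e pays for g itself, the other for dropping the constant g 0,
      which is small because \<phi> 0 = 0.\<close>
    then obtain g where g: "polynomial_function g" "\<And>y. y \<in> {0..1} \<Longrightarrow> cmod (\<phi> y - g y) < e / 2"
      using Stone_Weierstrass_polynomial_function[OF compact_Icc \<phi>c, of "e / 2"] by auto
    have "real_polynomial_function (Re \<circ> g)" "real_polynomial_function (Im \<circ> g)"
      using g(1) bounded_linear_Re bounded_linear_Im unfolding polynomial_function_def by auto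
    then have "resolvent_approx (\<lambda>s. of_real ((Re \<circ> g) (1 / (s\<^sup>2 + 1)) - (Re \<circ> g) 0) +
        \<i> * of_real ((Im \<circ> g) (1 / (s\<^sup>2 + 1)) - (Im \<circ> g) 0))"
      by (intro resolvent_approx.add resolvent_approx.scale resolvent_approx_polynomial)
    also have "(\<lambda>s. of_real ((Re \<circ> g) (1 / (s\<^sup>2 + 1)) - (Re \<circ> g) 0) +
        \<i> * of_real ((Im \<circ> g) (1 / (s\<^sup>2 + 1)) - (Im \<circ> g) 0)) = (\<lambda>s. g (1 / (s\<^sup>2 + 1)) - g 0)"
      by (rule ext) (simp add: complex_eq_iff)
    finally have "resolvent_approx (\<lambda>s. g (1 / (s\<^sup>2 + 1)) - g 0)" .
    moreover have "cmod (F s - (g (1 / (s\<^sup>2 + 1)) - g 0)) \<le> e" if "s \<ge> 0" for s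
    proof -
      let ?y = "1 / (s\<^sup>2 + 1)"
      have y: "0 < ?y" "?y \<le> 1" by (simp_all add: add_nonneg_pos)
      have "\<phi> ?y = F s" using y that by (simp add: \<phi>_def)
      moreover have "\<phi> 0 = 0" by (simp add: \<phi>_def)
      ultimately have "F s - (g ?y - g 0) = (\<phi> ?y - g ?y) - (\<phi> 0 - g 0)" by simp
      then have "cmod (F s - (g ?y - g 0)) \<le> cmod (\<phi> ?y - g ?y) + cmod (\<phi> 0 - g 0)"
        by (simp only: norm_triangle_ineq4)
      then show ?thesis using g(2)[of ?y] g(2)[of 0] y by auto
    qed
    ultimately show "\<exists>G. resolvent_approx G \<and> (\<forall>s\<ge>0. cmod (F s - G s) \<le> e)" by blast
  qed
qed

section \<open>Passage to singular value means\<close>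

lemma singular_values_nonneg:
  assumes A: "A \<in> carrier_mat n n" and s: "s \<in># singular_values A"
  shows "s \<ge> 0"
proof -
  have M: "mat_adjoint A * A \<in> carrier_mat n n" using A by simp
  obtain z where z: "z \<in># proots (char_poly (mat_adjoint A * A))" "s = sqrt (Re z)"
    using s by (auto simp: singular_values_def)
  have "poly (char_poly (mat_adjoint A * A)) z = 0"
    using degree_monic_char_poly[OF M] z(1) by (cases "char_poly (mat_adjoint A * A) = 0") auto
  from gram_eigenvalue(2)[OF A this] show ?thesis by (simp add: z(2))
qed

lemma norm_sum_mset_le:
  fixes f :: "'a \<Rightarrow> 'b::real_normed_vector"
  assumes "\<And>x. x \<in># M \<Longrightarrow> norm (f x) \<le> e"
  shows "norm (\<Sum>x\<in>#M. f x) \<le> real (size M) * e"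
  using assms
proof (induction M)
  case (add x M)
  have "norm (\<Sum>x\<in>#add_mset x M. f x) \<le> norm (f x) + norm (\<Sum>x\<in>#M. f x)"
    by (simp add: norm_triangle_ineq)
  also have "\<dots> \<le> e + real (size M) * e" using add by (intro add_mono) auto
  finally show ?case by (simp add: algebra_simps)
qed simp

lemma sv_mean_approx:
  assumes A: "A \<in> carrier_mat n n" and e: "e \<ge> 0" and FG: "\<And>s. s \<ge> 0 \<Longrightarrow> cmod (F s - G s) \<le> e"
  shows "cmod (sv_mean F A - sv_mean G A) \<le> e"
proof -
  have "(\<Sum>s\<in>#singular_values A. F s) - (\<Sum>s\<in>#singular_values A. G s) = (\<Sum>s\<in>#singular_values A. F s - G s)"
    using sum_mset.distrib[of "\<lambda>s. F s - G s" G "singular_values A"] by simp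
  then have "sv_mean F A - sv_mean G A = (\<Sum>s\<in>#singular_values A. F s - G s) / of_nat n"
    using A by (simp add: sv_mean_def diff_divide_distrib[symmetric])
  moreover have "cmod (\<Sum>s\<in>#singular_values A. F s - G s) \<le> real n * e"
    using norm_sum_mset_le[of "singular_values A" "\<lambda>s. F s - G s" e] FG singular_values_nonneg[OF A]
      size_singular_values[OF A] by simp
  \<comment> \<open>For n = 0 both means are quotients by 0, hence 0, and the claim rests on e \<ge>
    0.\<close>
  ultimately show ?thesis using e
    by (cases "n = 0") (simp_all add: norm_divide pos_divide_le_eq mult.commute)
qed

text \<open>Both the mean over the singular values and the normalised integral are linear in F and
  change by at most e when F changes by at most e on s \<ge> 0, so convergence passes from the
  generators to the closed span.\<close>

lemma sv_mean_tendsto_of_resolvents: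
  fixes \<theta> :: "'a \<Rightarrow> complex"
  assumes A: "\<And>n. A n \<in> carrier_mat n n"
    and M: "finite_measure M" "measure M (space M) = m" "m > 0"
    and \<theta> [measurable]: "\<theta> \<in> borel_measurable M"
    and res: "\<And>t. t > 0 \<Longrightarrow> (\<lambda>n. sv_mean (\<lambda>s. of_real (1 / (s\<^sup>2 + t))) (A n)) \<longlonglongrightarrow>
      (\<integral>z. of_real (1 / ((cmod (\<theta> z))\<^sup>2 + t)) \<partial>M) / of_real m"
    and F: "resolvent_approx F"
  shows "(\<lambda>n. sv_mean F (A n)) \<longlonglongrightarrow> (\<integral>z. F (cmod (\<theta> z)) \<partial>M) / of_real m"
proof -
  have int: "integrable M (\<lambda>z. F (cmod (\<theta> z)))" if F: "resolvent_approx F" for F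
  proof -
    obtain B where c: "continuous_on {0..} F" and B: "\<And>s. s \<ge> 0 \<Longrightarrow> cmod (F s) \<le> B"
      using resolvent_approx_continuous_bounded[OF F] by blast
    have "continuous_on UNIV (\<lambda>z. F (cmod z))"
      by (rule continuous_on_compose2[OF c]) (auto intro!: continuous_intros)
    then have "(\<lambda>z. F (cmod z)) \<in> borel_measurable borel"
      by (rule borel_measurable_continuous_onI)
    then have "(\<lambda>z. F (cmod (\<theta> z))) \<in> borel_measurable M"
      using measurable_compose[OF \<theta>] by blast
    then show ?thesis
      by (rule finite_measure.integrable_const_bound[OF M(1), rotated, of _ B]) (simp add: B)
  qed
  from F show ?thesis
  proof induction
    case (basic t)
    then show ?case by (rule res)
  next
    case (add F G)
    have "(\<integral>z. F (cmod (\<theta> z)) + G (cmod (\<theta> z)) \<partial>M) / of_real m =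
        (\<integral>z. F (cmod (\<theta> z)) \<partial>M) / of_real m + (\<integral>z. G (cmod (\<theta> z)) \<partial>M) / of_real m"
      using int[OF add.hyps(1)] int[OF add.hyps(2)] by (simp add: add_divide_distrib)
    moreover have "sv_mean (\<lambda>s. F s + G s) (A n) = sv_mean F (A n) + sv_mean G (A n)" for n
      by (simp add: sv_mean_def sum_mset.distrib add_divide_distrib)
    ultimately show ?case using tendsto_add[OF add.IH] by simp
  next
    case (scale F c)
    have "(\<Sum>s\<in>#S. c * F s) = c * (\<Sum>s\<in>#S. F s)" for S
      by (induction S) (simp_all add: distrib_left)
    then have "sv_mean (\<lambda>s. c * F s) (A n) = c * sv_mean F (A n)" for n
      by (simp add: sv_mean_def)
    then show ?case using tendsto_mult_left[OF scale.IH, of c] by simp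
  next
    case (limit F)
    have F': "resolvent_approx F"
      by (rule resolvent_approx.limit) (use limit.IH in blast)
    show ?case
    proof (rule LIMSEQ_uniform_approx)
      fix e :: real assume e: "e > 0"
      from limit.IH[OF e] obtain G where G: "resolvent_approx G" 
        "(\<lambda>n. sv_mean G (A n)) \<longlonglongrightarrow> (\<integral>z. G (cmod (\<theta> z)) \<partial>M) / of_real m"
        and FG: "\<And>s. s \<ge> 0 \<Longrightarrow> cmod (F s - G s) \<le> e" by blast
      have "cmod ((\<integral>z. F (cmod (\<theta> z)) \<partial>M) - (\<integral>z. G (cmod (\<theta> z)) \<partial>M)) =
          cmod (\<integral>z. F (cmod (\<theta> z)) - G (cmod (\<theta> z)) \<partial>M)"
        using int[OF F'] int[OF G(1)] by simp
      also have "\<dots> \<le> (\<integral>z. cmod (F (cmod (\<theta> z)) - G (cmod (\<theta> z))) \<partial>M)" by (rule integral_norm_bound)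
      also have "\<dots> \<le> (\<integral>z. e \<partial>M)"
        using int[OF F'] int[OF G(1)] FG
        by (intro integral_mono integrable_norm Bochner_Integration.integrable_diff
          finite_measure.integrable_const[OF M(1)]) auto
      also have "\<dots> = e * m" using M by simp
      finally have "dist ((\<integral>z. F (cmod (\<theta> z)) \<partial>M) / of_real m) ((\<integral>z. G (cmod (\<theta> z)) \<partial>M) / of_real m) \<le> e"
        using M(3) by (simp add: dist_norm diff_divide_distrib[symmetric] norm_divide field_simps)
      moreover have "dist (sv_mean F (A n)) (sv_mean G (A n)) \<le> e" for n
        unfolding dist_norm using e by (intro sv_mean_approx[OF A] FG) auto
      ultimately show "\<exists>y l. y \<longlonglongrightarrow> l \<and> (\<forall>n. dist (sv_mean F (A n)) (y n) \<le> e) \<and>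
          dist ((\<integral>z. F (cmod (\<theta> z)) \<partial>M) / of_real m) l \<le> e"
        using G(2) by blast
    qed
  qed
qed

section \<open>The symbol on the rectangle\<close>

lemma AE_lebesgue_iff_negligible:
  fixes P :: "'a::euclidean_space \<Rightarrow> bool"
  shows "(AE x in lebesgue. P x) \<longleftrightarrow> negligible {x. \<not> P x}"
  by (simp add: completion.AE_iff_null_sets negligible_iff_null_sets)

lemma AE_lebesgue_affine:
  fixes P :: "real \<Rightarrow> bool"
  assumes "AE x in lebesgue. P x" "c \<noteq> 0"
  shows "AE x in lebesgue. P ((x + b) / c)"
  unfolding AE_lebesgue_iff_negligible
proof (rule negligible_subset)
  show "negligible ((\<lambda>y. c * y - b) ` {y. \<not> P y})"
    using assms(1) unfolding AE_lebesgue_iff_negligible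
    by (rule negligible_differentiable_image_negligible[OF order_refl])
      (auto intro!: differentiable_on_diff differentiable_on_mult differentiable_on_const differentiable_on_ident)
  show "{x. \<not> P ((x + b) / c)} \<subseteq> (\<lambda>y. c * y - b) ` {y. \<not> P y}"
  proof
    fix x assume "x \<in> {x. \<not> P ((x + b) / c)}"
    then show "x \<in> (\<lambda>y. c * y - b) ` {y. \<not> P y}"
      using assms(2) by (intro image_eqI[of _ _ "(x + b) / c"]) auto
  qed
qed

text \<open>Lebesgue measure on the product is the completion of a product measure, so the
  exceptional set is first enlarged to a Borel null set, whose cylinder is null in the
  product.\<close>

lemma AE_lebesgue_fst:
  fixes P :: "'a::euclidean_space \<Rightarrow> bool"
  assumes "AE x in lebesgue. P x"
  shows "AE z in (lebesgue :: ('a \<times> 'b::euclidean_space) measure). P (fst z)"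
proof -
  have "{x. \<not> P x} \<in> null_sets (completion lborel)"
    using assms by (simp add: completion.AE_iff_null_sets)
  then obtain N where N: "N \<in> null_sets lborel" "{x. \<not> P x} \<subseteq> N"
    unfolding null_sets_completion_iff2 by blast
  have "N \<times> (UNIV :: 'b set) \<in> null_sets (lborel \<Otimes>\<^sub>M lborel)"
    using N(1) by (intro lborel.times_in_null_sets1) auto
  then have "N \<times> (UNIV :: 'b set) \<in> null_sets lborel" by (simp only: lborel_prod)
  then have "{z :: 'a \<times> 'b. \<not> P (fst z)} \<in> null_sets (completion lborel)"
    unfolding null_sets_completion_iff2 using N(2) by (intro bexI[of _ "N \<times> UNIV"]) auto
  then show ?thesis by (simp add: completion.AE_iff_null_sets)
qed

text \<open>The trigonometric sums are periodic, so failure is confined to the countably many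
  translates of one null set by multiples of 2 pi.\<close>

lemma AE_periodic_ext:
  assumes "AE x in Qm. (\<lambda>k. trig_sum (q k) (a k) x) \<longlonglongrightarrow> f x"
  shows "AE x in lebesgue. (\<lambda>k. trig_sum (q k) (a k) x) \<longlonglongrightarrow> periodic_ext f x"
proof -
  let ?P = "\<lambda>x. (\<lambda>k. trig_sum (q k) (a k) x) \<longlonglongrightarrow> f x"
  \<comment> \<open>The representative modulo 2 pi ranges over [-pi, pi), and its left end lies
    outside the open interval of the assumption.\<close>
  define N where "N = insert (-pi) {x. \<not> (x \<in> {-pi<..<pi} \<longrightarrow> ?P x)}"
  have "AE x in lebesgue. x \<in> {-pi<..<pi} \<longrightarrow> ?P x"
    using assms by (subst (asm) AE_restrict_space_iff) auto
  then have N: "negligible N"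
    unfolding AE_lebesgue_iff_negligible N_def by (simp only: negligible_insert)
  have neg: "negligible (\<Union>m::int. (+) (2 * pi * real_of_int m) ` N)"
    by (intro negligible_countable_Union) (auto intro: negligible_translation N)
  show ?thesis unfolding AE_lebesgue_iff_negligible
  proof (rule negligible_subset[OF neg], intro subsetI, rule ccontr)
    fix x assume x: "x \<in> {x. \<not> (\<lambda>k. trig_sum (q k) (a k) x) \<longlonglongrightarrow> periodic_ext f x}"
      and nx: "x \<notin> (\<Union>m::int. (+) (2 * pi * real_of_int m) ` N)"
    define m where "m = \<lfloor>(x + pi) / \<bar>2 * pi\<bar>\<rfloor>"
    define y where "y = (x + pi) rmod (2 * pi) - pi"
    have "x = 2 * pi * real_of_int m + y" by (simp add: y_def rmod_def m_def)
    with nx have "y \<notin> N" by blast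
    moreover have "-pi \<le> y" "y < pi"
      using rmod_nonneg[of "2 * pi" "x + pi"] rmod_less[of "2 * pi" "x + pi"] by (auto simp: y_def)
    ultimately have "?P y" by (auto simp: N_def)
    moreover have "trig_sum (q k) (a k) y = trig_sum (q k) (a k) x" for k
      using fun_cong[OF periodic_ext_trig_sum, of "q k" "a k" x] by (simp add: periodic_ext_def y_def)
    ultimately have "(\<lambda>k. trig_sum (q k) (a k) x) \<longlonglongrightarrow> f y" by simp
    then show False using x by (simp add: periodic_ext_def y_def)
  qed
qed

lemma AE_hat_abs_sq_tendsto:
  assumes "AE x in Qm. (\<lambda>k. trig_sum (q k) (a k) x) \<longlonglongrightarrow> f x" "\<alpha> \<ge> 1"
  shows "AE x in lebesgue. (\<lambda>k. hat_abs_sq (trig_sum (q k) (a k)) \<alpha> x) \<longlonglongrightarrow> hat_abs_sq f \<alpha> x"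
proof -
  have "AE x in lebesgue. \<forall>j<\<alpha>. (\<lambda>k. trig_sum (q k) (a k) ((x + 2 * pi * real j) / real \<alpha>))
      \<longlonglongrightarrow> periodic_ext f ((x + 2 * pi * real j) / real \<alpha>)"
    using AE_lebesgue_affine[OF AE_periodic_ext[OF assms(1)], of "real \<alpha>"] assms(2)
    by (simp add: AE_all_countable)
  then show ?thesis
  proof eventually_elim
    case (elim x)
    then show ?case unfolding hat_abs_sq_def periodic_ext_trig_sum
      by (intro tendsto_intros) auto
  qed
qed

lemma AE_theta_symbol_tendsto:
  assumes "AE x in Qm. (\<lambda>k. trig_sum (q k) (a k) x) \<longlonglongrightarrow> f x" "\<alpha> \<ge> 1"
  shows "AE z in lebesgue. (\<lambda>k. theta_symbol (trig_sum (q k) (a k)) \<alpha> z) \<longlonglongrightarrow> theta_symbol f \<alpha> z"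
  using AE_lebesgue_fst[OF AE_hat_abs_sq_tendsto[OF assms], where ?'b = real]
proof eventually_elim
  case (elim z)
  then show ?case unfolding theta_symbol_def
    by (cases z) (auto intro!: tendsto_intros)
qed

lemma theta_symbol_trig_sum_borel [measurable]:
  "theta_symbol (trig_sum q a) \<alpha> \<in> borel_measurable borel"
proof -
  have [measurable]: "hat_abs_sq (trig_sum q a) \<alpha> \<in> borel_measurable borel"
    by (rule borel_measurable_continuous_onI[OF continuous_hat_abs_sq_trig_sum])
  show ?thesis
    unfolding theta_symbol_def borel_prod[symmetric] by measurable
qed

lemma borel_imp_lebesgue_measurable:
  "f \<in> borel_measurable borel \<Longrightarrow> f \<in> borel_measurable lebesgue"
  by (rule measurable_completion) simp

section \<open>Integration of the symbol over the rectangle\<close>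

abbreviation rectangle :: "(real \<times> real) set" where
  "rectangle \<equiv> {-pi<..<pi} \<times> {0..1}"

lemma rectangle_emeasure: "rectangle \<in> sets lborel" "emeasure lborel rectangle = ennreal (2 * pi)"
proof -
  have *: "rectangle \<in> sets (lborel \<Otimes>\<^sub>M lborel)" by (intro pair_measureI) auto
  then show "rectangle \<in> sets lborel" by (simp only: lborel_prod)
  have "emeasure (lborel \<Otimes>\<^sub>M lborel) rectangle = emeasure lborel {-pi<..<pi} * emeasure lborel {0..1::real}"
    by (rule lborel.emeasure_pair_measure_Times) auto
  then show "emeasure lborel rectangle = ennreal (2 * pi)" by (simp add: lborel_prod)
qed

lemma rectangle_lmeasurable: "rectangle \<in> lmeasurable" "measure lebesgue rectangle = 2 * pi"
  using rectangle_emeasure by (auto simp: fmeasurable_def measure_def)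

lemma rectangle_measure: "finite_measure (lebesgue_on rectangle)" "measure (lebesgue_on rectangle) (space (lebesgue_on rectangle)) = 2 * pi"
  using rectangle_lmeasurable
  by (auto intro!: finite_measure_lebesgue_on simp: measure_restrict_space space_restrict_space)

text \<open>Since f is only Lebesgue measurable, composition is not a safe route. Instead the symbol
  is almost everywhere the limit of the Borel symbols of polynomials, and completeness of the
  measure transfers measurability.\<close>

lemma theta_symbol_measurable:
  assumes "integrable Qm f" "\<alpha> \<ge> 1"
  shows "theta_symbol f \<alpha> \<in> borel_measurable (lebesgue_on rectangle)"
proof -
  obtain q a where "AE x in Qm. (\<lambda>k. trig_sum (q k) (a k) x) \<longlonglongrightarrow> f x"
    using trig_sum_approx_sequence[OF assms(1)] by blast
  note AE = AE_theta_symbol_tendsto[OF this assms(2)]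
  have "(\<lambda>z. lim (\<lambda>k. theta_symbol (trig_sum (q k) (a k)) \<alpha> z)) \<in> borel_measurable lebesgue"
    by (intro borel_measurable_lim_metric borel_imp_lebesgue_measurable theta_symbol_trig_sum_borel)
  moreover have "AE z in lebesgue. lim (\<lambda>k. theta_symbol (trig_sum (q k) (a k)) \<alpha> z) = theta_symbol f \<alpha> z"
    using AE by eventually_elim (rule limI)
  ultimately have "theta_symbol f \<alpha> \<in> borel_measurable lebesgue"
    by (rule borel_measurable_AE)
  then show ?thesis by (rule measurable_restrict_space1)
qed

lemma theta_symbol_integral_tendsto:
  fixes F :: "real \<Rightarrow> complex"
  assumes "AE x in Qm. (\<lambda>k. trig_sum (q k) (a k) x) \<longlonglongrightarrow> f x" "\<alpha> \<ge> 1" "integrable Qm f"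
    and F: "continuous_on UNIV F" "\<And>s. cmod (F s) \<le> B"
  shows "(\<lambda>k. \<integral>z. F (cmod (theta_symbol (trig_sum (q k) (a k)) \<alpha> z)) \<partial>lebesgue_on rectangle)
    \<longlonglongrightarrow> (\<integral>z. F (cmod (theta_symbol f \<alpha> z)) \<partial>lebesgue_on rectangle)"
proof (rule integral_dominated_convergence[where w = "\<lambda>_. B"])
  have F': "(\<lambda>z. F (cmod z)) \<in> borel_measurable borel"
    by (intro borel_measurable_continuous_onI continuous_on_compose2[OF F(1)] continuous_intros) auto
  show "(\<lambda>z. F (cmod (theta_symbol f \<alpha> z))) \<in> borel_measurable (lebesgue_on rectangle)"
    by (rule measurable_compose[OF theta_symbol_measurable[OF assms(3,2)] F'])
  show "(\<lambda>z. F (cmod (theta_symbol (trig_sum (q k) (a k)) \<alpha> z))) \<in> borel_measurable (lebesgue_on rectangle)" for k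
    by (rule measurable_compose[OF theta_symbol_measurable[OF integrable_trig_sum assms(2)] F'])
  have "AE z in lebesgue_on rectangle. (\<lambda>k. theta_symbol (trig_sum (q k) (a k)) \<alpha> z) \<longlonglongrightarrow> theta_symbol f \<alpha> z"
    using AE_theta_symbol_tendsto[OF assms(1,2)] rectangle_lmeasurable
    by (subst AE_restrict_space_iff) auto
  then show "AE z in lebesgue_on rectangle. (\<lambda>k. F (cmod (theta_symbol (trig_sum (q k) (a k)) \<alpha> z)))
      \<longlonglongrightarrow> F (cmod (theta_symbol f \<alpha> z))"
  proof eventually_elim
    case (elim z)
    show ?case
      by (rule isCont_tendsto_compose[OF _ tendsto_norm[OF elim]])
        (use F(1) in \<open>simp add: continuous_on_eq_continuous_at\<close>)
  qed
  show "integrable (lebesgue_on rectangle) (\<lambda>_. B)"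
    by (rule finite_measure.integrable_const[OF rectangle_measure(1)])
qed (use F(2) in auto)

text \<open>For a polynomial the symbol is Borel, so the integral can be moved from the completed
  measure to \<open>lborel\<close>, where Fubini applies; the remaining integral in x is moved back
  afterwards.\<close>

lemma theta_symbol_integral_trig_sum:
  fixes F :: "real \<Rightarrow> complex"
  assumes \<alpha>: "\<alpha> \<ge> 1" and F: "continuous_on UNIV F" "\<And>s. cmod (F s) \<le> B"
  shows "(\<integral>z. F (cmod (theta_symbol (trig_sum q a) \<alpha> z)) \<partial>lebesgue_on rectangle) =
    of_real (1 / real \<alpha>) * (\<integral>x. F (sqrt (hat_abs_sq (trig_sum q a) \<alpha> x)) \<partial>Qm) +
    of_real (1 - 1 / real \<alpha>) * (2 * of_real pi * F 0)"
proof -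
  define h where "h = hat_abs_sq (trig_sum q a) \<alpha>"
  define \<Phi> where "\<Phi> z = F (cmod (theta_symbol (trig_sum q a) \<alpha> z))" for z
  have F': "(\<lambda>z. F (cmod z)) \<in> borel_measurable borel"
    by (intro borel_measurable_continuous_onI continuous_on_compose2[OF F(1)] continuous_intros) auto
  have \<Phi>m: "\<Phi> \<in> borel_measurable borel"
    unfolding \<Phi>_def[abs_def] by (rule measurable_compose[OF theta_symbol_trig_sum_borel F'])
  have \<Phi>i: "integrable lborel (\<lambda>z. indicator rectangle z *\<^sub>R \<Phi> z)"
  proof (rule Bochner_Integration.integrable_bound)
    show "integrable lborel (\<lambda>z. indicator rectangle z *\<^sub>R B)"
      using rectangle_emeasure by (intro integrable_scaleR_left) (auto simp: integrable_indicator_iff)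
    show "(\<lambda>z. indicator rectangle z *\<^sub>R \<Phi> z) \<in> borel_measurable lborel"
      using \<Phi>m rectangle_emeasure(1) by (intro borel_measurable_scaleR borel_measurable_indicator) auto
    show "AE z in lborel. norm (indicator rectangle z *\<^sub>R \<Phi> z) \<le> norm (indicator rectangle z *\<^sub>R B)"
      using F(2) by (intro AE_I2) (auto simp: \<Phi>_def indicator_def intro: order_trans[OF F(2) abs_ge_self])
  qed
  \<comment> \<open>For fixed x the symbol is constant on two intervals in t of lengths 1 / \<alpha>
    and 1 - 1 / \<alpha>.\<close>
  have inner: "(\<integral>t. indicator rectangle (x, t) *\<^sub>R \<Phi> (x, t) \<partial>lborel) =
      indicator {-pi<..<pi} x *\<^sub>R ((1 / real \<alpha>) *\<^sub>R F (sqrt (h x)) + (1 - 1 / real \<alpha>) *\<^sub>R F 0)" for x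
  proof -
    have le: "1 / real \<alpha> \<le> 1" using \<alpha> by simp
    have ge: "0 \<le> t" if "1 / real \<alpha> < t" for t
      using that by (meson divide_nonneg_nonneg less_imp_le of_nat_0_le_iff order_trans zero_le_one)
    have "h x \<ge> 0" by (simp add: h_def hat_abs_sq_nonneg)
    then have "indicator rectangle (x, t) *\<^sub>R \<Phi> (x, t) = indicator {-pi<..<pi} x *\<^sub>R
        (indicator {0..1 / real \<alpha>} t *\<^sub>R F (sqrt (h x)) + indicator {1 / real \<alpha><..1} t *\<^sub>R F 0)" for t
      using le ge by (auto simp: \<Phi>_def theta_symbol_def h_def indicator_def)
    moreover have "(\<integral>t. indicator {0..1 / real \<alpha>} t *\<^sub>R F (sqrt (h x)) + indicator {1 / real \<alpha><..1} t *\<^sub>R F 0 \<partial>lborel) =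
        (1 / real \<alpha>) *\<^sub>R F (sqrt (h x)) + (1 - 1 / real \<alpha>) *\<^sub>R F 0"
      using le by (subst Bochner_Integration.integral_add) (auto simp: integrable_indicator_iff)
    ultimately show ?thesis by simp
  qed
  have Fh: "integrable Qm (\<lambda>x. F (sqrt (h x)))"
    by (rule integrable_Qm_bounded[OF continuous_measurable_Qm F(2)])
      (auto simp: h_def intro!: continuous_on_compose2[OF F(1)] continuous_intros continuous_hat_abs_sq_trig_sum)
  have "(\<integral>z. \<Phi> z \<partial>lebesgue_on rectangle) = (\<integral>z. indicator rectangle z *\<^sub>R \<Phi> z \<partial>lebesgue)"
    using rectangle_lmeasurable by (subst integral_restrict_space) auto
  also have "\<dots> = (\<integral>z. indicator rectangle z *\<^sub>R \<Phi> z \<partial>lborel)"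
    using \<Phi>i by (intro integral_completion) auto
  also have "\<dots> = (\<integral>x. \<integral>t. indicator rectangle (x, t) *\<^sub>R \<Phi> (x, t) \<partial>lborel \<partial>lborel)"
    using lborel_pair.integral_fst'[of "\<lambda>z. indicator rectangle z *\<^sub>R \<Phi> z"] \<Phi>i by (simp add: lborel_prod)
  also have "\<dots> = (\<integral>x. indicator {-pi<..<pi} x *\<^sub>R ((1 / real \<alpha>) *\<^sub>R F (sqrt (h x)) + (1 - 1 / real \<alpha>) *\<^sub>R F 0) \<partial>lborel)"
    by (simp only: inner)
  also have "\<dots> = (\<integral>x. indicator {-pi<..<pi} x *\<^sub>R ((1 / real \<alpha>) *\<^sub>R F (sqrt (h x)) + (1 - 1 / real \<alpha>) *\<^sub>R F 0) \<partial>lebesgue)"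
  proof (rule integral_completion[symmetric])
    have "continuous_on UNIV (\<lambda>x. F (sqrt (h x)))"
      by (auto simp: h_def intro!: continuous_on_compose2[OF F(1)] continuous_intros continuous_hat_abs_sq_trig_sum)
    then have [measurable]: "(\<lambda>x. F (sqrt (h x))) \<in> borel_measurable borel"
      by (rule borel_measurable_continuous_onI)
    show "(\<lambda>x. indicator {-pi<..<pi} x *\<^sub>R ((1 / real \<alpha>) *\<^sub>R F (sqrt (h x)) + (1 - 1 / real \<alpha>) *\<^sub>R F 0)) \<in> borel_measurable lborel"
      by measurable
  qed
  also have "\<dots> = (\<integral>x. (1 / real \<alpha>) *\<^sub>R F (sqrt (h x)) + (1 - 1 / real \<alpha>) *\<^sub>R F 0 \<partial>Qm)"
    by (subst integral_restrict_space) auto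
  also have "\<dots> = (\<integral>x. (1 / real \<alpha>) *\<^sub>R F (sqrt (h x)) \<partial>Qm) + (\<integral>x. (1 - 1 / real \<alpha>) *\<^sub>R F 0 \<partial>Qm)"
    by (intro Bochner_Integration.integral_add integrable_scaleR_right Fh finite_measure.integrable_const[OF finite_measure_Qm])
  also have "(\<integral>x. (1 - 1 / real \<alpha>) *\<^sub>R F 0 \<partial>Qm) = (2 * pi) *\<^sub>R ((1 - 1 / real \<alpha>) *\<^sub>R F 0)"
    using measure_Qm(1) by (simp only: lebesgue_integral_const)
  also have "(\<integral>x. (1 / real \<alpha>) *\<^sub>R F (sqrt (h x)) \<partial>Qm) = (1 / real \<alpha>) *\<^sub>R (\<integral>x. F (sqrt (h x)) \<partial>Qm)"
    by (rule integral_scaleR_right)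
  finally show ?thesis
    unfolding \<Phi>_def h_def by (simp add: scaleR_conv_of_real mult_ac)
qed

section \<open>Convergence of the resolvent means\<close>

lemma sv_mean_resolvent:
  assumes "resolvent_mat n t A R" "t > 0"
  shows "sv_mean (\<lambda>s. of_real (1 / (s\<^sup>2 + t))) A = mtrace R / of_nat n"
  using assms(1) by (simp only: sv_mean_def sum_singular_values_resolvent[OF assms]) (auto simp: resolvent_mat_def)

lemma alpha_toeplitz_carrier: "alpha_toeplitz f \<alpha> n \<in> carrier_mat n n"
  by (simp add: alpha_toeplitz_def)

text \<open>The square in the test function undoes the square root in the symbol, and
  \<open>\<gamma> 0\<close> is the mean of 1 / (h + t) over the interval; so the limit of the traces
  already is the integral over the rectangle.\<close>

lemma sv_mean_trig_sum_tendsto: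
  assumes "\<alpha> \<ge> 1" "t > 0"
  shows "(\<lambda>n. sv_mean (\<lambda>s. of_real (1 / (s\<^sup>2 + t))) (alpha_toeplitz (trig_sum q a) \<alpha> n)) \<longlonglongrightarrow>
    (\<integral>z. of_real (1 / ((cmod (theta_symbol (trig_sum q a) \<alpha> z))\<^sup>2 + t)) \<partial>lebesgue_on rectangle) / of_real (2 * pi)"
proof -
  interpret trig_symbol q a \<alpha> t using assms by unfold_locales
  let ?F = "\<lambda>s. complex_of_real (1 / (s\<^sup>2 + t))"
  have "\<forall>n. \<exists>R. resolvent_mat n t (alpha_toeplitz (trig_sum q a) \<alpha> n) R"
    using resolvent_exists[OF alpha_toeplitz_carrier assms(2)] by blast
  then obtain R where R: "\<And>n. resolvent_mat n t (alpha_toeplitz (trig_sum q a) \<alpha> n) (R n)"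
    by metis
  have nz: "s\<^sup>2 + t \<noteq> 0" for s using assms(2) by (metis add_nonneg_pos less_irrefl zero_le_power2)
  have Fc: "continuous_on UNIV ?F" by (intro continuous_intros) (use nz in auto)
  have Fb: "cmod (?F s) \<le> 1 / t" for s
    using assms(2) unfolding norm_of_real by (simp add: frac_le add_pos_nonneg)
  have "(\<integral>z. ?F (cmod (theta_symbol (trig_sum q a) \<alpha> z)) \<partial>lebesgue_on rectangle) / of_real (2 * pi) =
      (of_real (1 / real \<alpha>) * (\<integral>x. ?F (sqrt (h x)) \<partial>Qm) + of_real (1 - 1 / real \<alpha>) * (2 * of_real pi * ?F 0)) / of_real (2 * pi)"
    unfolding theta_symbol_integral_trig_sum[OF assms(1) Fc Fb] h_def ..
  also have "(\<lambda>x. ?F (sqrt (h x))) = (\<lambda>x. of_real (1 / (h x + t)))"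
    by (rule ext) (simp add: h_def hat_abs_sq_nonneg)
  also have "(of_real (1 / real \<alpha>) * (\<integral>x. of_real (1 / (h x + t)) \<partial>Qm) + of_real (1 - 1 / real \<alpha>) * (2 * of_real pi * ?F 0)) / of_real (2 * pi) =
      of_real (1 / real \<alpha>) * \<gamma> 0 + of_real (1 - 1 / real \<alpha>) * of_real (1 / t)"
    unfolding \<gamma>_def fourier_coeff_cis by (simp add: add_divide_distrib del: integral_complex_of_real)
  finally show ?thesis
    using trace_resolvent_tendsto[OF R] unfolding sv_mean_resolvent[OF R assms(2)] by simp
qed

text \<open>The bound does not depend on n, which allows approximation of f before n tends to
  infinity.\<close>

lemma sv_mean_resolvent_perturb:
  assumes "integrable Qm f" "integrable Qm g" "t > 0"
  shows "cmod (sv_mean (\<lambda>s. of_real (1 / (s\<^sup>2 + t))) (alpha_toeplitz f \<alpha> n) -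
      sv_mean (\<lambda>s. of_real (1 / (s\<^sup>2 + t))) (alpha_toeplitz g \<alpha> n))
    \<le> 2 / (t * sqrt t) * ((\<integral>x. cmod (f x - g x) \<partial>Qm) / (2 * pi))"
proof -
  let ?A = "alpha_toeplitz f \<alpha> n" and ?B = "alpha_toeplitz g \<alpha> n"
  let ?e = "(\<integral>x. cmod (f x - g x) \<partial>Qm) / (2 * pi)"
  obtain R S where R: "resolvent_mat n t ?A R" and S: "resolvent_mat n t ?B S"
    using resolvent_exists[OF alpha_toeplitz_carrier assms(3)] by metis
  have fg: "integrable Qm (\<lambda>x. g x - f x)" using assms by simp
  have "cmod (mtrace R - mtrace S) \<le> 2 / (t * sqrt t) * real n * ?e"
  proof (rule resolvent_trace_perturb[OF R S assms(3)])
    fix Z :: "nat \<Rightarrow> nat \<Rightarrow> complex" and K :: real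
    assume Z: "\<And>u v :: nat \<Rightarrow> complex. (\<And>i. cmod (u i) = 1) \<Longrightarrow> (\<And>i. cmod (v i) = 1) \<Longrightarrow>
         cmod (\<Sum>r<n. \<Sum>c<n. u r * Z r c * v c) \<le> K * real n"
    have "(\<Sum>r<n. \<Sum>c<n. (?B $$ (r, c) - ?A $$ (r, c)) * Z r c) =
        (\<Sum>r<n. \<Sum>c<n. fourier_coeff (\<lambda>x. g x - f x) (int r - int \<alpha> * int c) * Z r c)"
      by (simp add: alpha_toeplitz_def fourier_coeff_diff assms)
    also have "cmod \<dots> \<le> K * real n * ((\<integral>x. cmod (g x - f x) \<partial>Qm) / (2 * pi))"
      by (rule alpha_toeplitz_pairing_bound[OF fg Z])
    finally show "cmod (\<Sum>r<n. \<Sum>c<n. (?B $$ (r, c) - ?A $$ (r, c)) * Z r c) \<le> K * real n * ?e"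
      by (simp only: norm_minus_commute)
  qed
  \<comment> \<open>Settles n = 0, where both means are 0.\<close>
  moreover have "0 \<le> ?e" by (simp add: integral_nonneg)
  ultimately show ?thesis
    using assms(3) unfolding sv_mean_resolvent[OF R assms(3)] sv_mean_resolvent[OF S assms(3)] diff_divide_distrib[symmetric]
    by (cases "n = 0") (simp_all add: norm_divide field_simps)
qed

lemma sv_mean_resolvent_tendsto:
  assumes f: "integrable Qm f" and \<alpha>: "\<alpha> \<ge> 1" and t: "t > 0"
  shows "(\<lambda>n. sv_mean (\<lambda>s. of_real (1 / (s\<^sup>2 + t))) (alpha_toeplitz f \<alpha> n)) \<longlonglongrightarrow>
    (\<integral>z. of_real (1 / ((cmod (theta_symbol f \<alpha> z))\<^sup>2 + t)) \<partial>lebesgue_on rectangle) / of_real (2 * pi)"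
proof (rule LIMSEQ_uniform_approx)
  fix e :: real assume e: "e > 0"
  let ?F = "\<lambda>s. complex_of_real (1 / (s\<^sup>2 + t))"
  let ?L = "\<lambda>f. (\<integral>z. ?F (cmod (theta_symbol f \<alpha> z)) \<partial>lebesgue_on rectangle) / of_real (2 * pi)"
  have nz: "s\<^sup>2 + t \<noteq> 0" for s using t by (metis add_nonneg_pos less_irrefl zero_le_power2)
  have Fc: "continuous_on UNIV ?F" by (intro continuous_intros) (use nz in auto)
  have Fb: "cmod (?F s) \<le> 1 / t" for s
    using t unfolding norm_of_real by (simp add: frac_le add_pos_nonneg)
  obtain q a where L1: "(\<lambda>k. \<integral>x. cmod (f x - trig_sum (q k) (a k) x) \<partial>Qm) \<longlonglongrightarrow> 0"
    and AE: "AE x in Qm. (\<lambda>k. trig_sum (q k) (a k) x) \<longlonglongrightarrow> f x"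
    using trig_sum_approx_sequence[OF f] by blast
  have "(\<lambda>k. 2 / (t * sqrt t) * ((\<integral>x. cmod (f x - trig_sum (q k) (a k) x) \<partial>Qm) / (2 * pi))) \<longlonglongrightarrow> 2 / (t * sqrt t) * (0 / (2 * pi))"
    by (intro tendsto_intros L1) simp
  then have "\<forall>\<^sub>F k in sequentially. 2 / (t * sqrt t) * ((\<integral>x. cmod (f x - trig_sum (q k) (a k) x) \<partial>Qm) / (2 * pi)) < e"
    using e by (intro order_tendstoD(2)) auto
  moreover have "(\<lambda>k. ?L (trig_sum (q k) (a k))) \<longlonglongrightarrow> ?L f"
    by (intro tendsto_divide tendsto_const theta_symbol_integral_tendsto[OF AE \<alpha> f Fc Fb]) simp
  then have "\<forall>\<^sub>F k in sequentially. dist (?L (trig_sum (q k) (a k))) (?L f) < e"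
    using e by (rule tendstoD)
  \<comment> \<open>A single polynomial has to be close to f on both sides at once: for the
    matrices, uniformly in n, and for the limit integral.\<close>
  ultimately have "\<forall>\<^sub>F k in sequentially. 2 / (t * sqrt t) * ((\<integral>x. cmod (f x - trig_sum (q k) (a k) x) \<partial>Qm) / (2 * pi)) < e \<and>
      dist (?L (trig_sum (q k) (a k))) (?L f) < e" by eventually_elim simp
  then obtain k where k: "2 / (t * sqrt t) * ((\<integral>x. cmod (f x - trig_sum (q k) (a k) x) \<partial>Qm) / (2 * pi)) < e"
      "dist (?L (trig_sum (q k) (a k))) (?L f) < e"
    using eventually_happens'[OF sequentially_bot] by blast
  show "\<exists>y m. y \<longlonglongrightarrow> m \<and> (\<forall>n. dist (sv_mean ?F (alpha_toeplitz f \<alpha> n)) (y n) \<le> e) \<and> dist (?L f) m \<le> e"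
  proof (intro exI conjI allI)
    show "(\<lambda>n. sv_mean ?F (alpha_toeplitz (trig_sum (q k) (a k)) \<alpha> n)) \<longlonglongrightarrow> ?L (trig_sum (q k) (a k))"
      by (rule sv_mean_trig_sum_tendsto[OF \<alpha> t])
    show "dist (sv_mean ?F (alpha_toeplitz f \<alpha> n)) (sv_mean ?F (alpha_toeplitz (trig_sum (q k) (a k)) \<alpha> n)) \<le> e" for n
      unfolding dist_norm
      by (rule order_trans[OF sv_mean_resolvent_perturb[OF f integrable_trig_sum t] less_imp_le[OF k(1)]])
    show "dist (?L f) (?L (trig_sum (q k) (a k))) \<le> e"
      using k(2) by (simp only: dist_commute less_imp_le)
  qed
qed

theorem mainTheorem2:
  fixes f :: "real \<Rightarrow> complex" and \<alpha> :: nat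
  assumes "set_integrable lebesgue {-pi<..<pi} f"
    and "\<alpha> \<ge> 1"
  shows "sv_distributed (alpha_toeplitz f \<alpha>) (theta_symbol f \<alpha>) ({-pi<..<pi} \<times> {0..1})"
proof -
  have f: "integrable Qm f"
    using assms(1) by (simp add: set_integrable_def integrable_restrict_space)
  have "(\<lambda>n. sv_mean F (alpha_toeplitz f \<alpha> n)) \<longlonglongrightarrow>
      (LINT z:rectangle|lebesgue. F (cmod (theta_symbol f \<alpha> z))) / of_real (measure lebesgue rectangle)"
    if "F \<in> C0_nonneg" for F
  proof -
    have "(LINT z:rectangle|lebesgue. F (cmod (theta_symbol f \<alpha> z))) =
        (\<integral>z. F (cmod (theta_symbol f \<alpha> z)) \<partial>lebesgue_on rectangle)"
      using rectangle_lmeasurable unfolding set_lebesgue_integral_def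
      by (subst integral_restrict_space) auto
    then show ?thesis
      unfolding rectangle_lmeasurable(2)
      using sv_mean_tendsto_of_resolvents[OF alpha_toeplitz_carrier rectangle_measure _ theta_symbol_measurable[OF f assms(2)]
          sv_mean_resolvent_tendsto[OF f assms(2)] C0_resolvent_approx[OF that]]
      by simp
  qed
  then show ?thesis
    unfolding sv_distributed_def
    using alpha_toeplitz_carrier rectangle_lmeasurable theta_symbol_measurable[OF f assms(2)] by auto
qed

end
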